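(* Let $\mathfrak B_{\widehat{\mathcal A},\widehat{\mathcal E},\widehat M}$ be a reduced Bratteli diagram with bounded alphabet size. (i) Let $\widehat{\mathbf w}\in\mathrm{Ext}\,\mathcal V_{\widehat M}$. Then there exists an eventually unique maximal primitive $M\le\widehat M$ such that there exists $\mathbf w\in\mathcal V_M$ which is $\widehat M/M$-distinguished, with $\widehat{\mathbf w}=\iota(\mathbf w)$. (ii) Let $\widehat{\mathbf w}\in\mathcal V_{\widehat M}$. Then there exist unique primitive submatrices $A_k$ with disjoint streams and a unique decomposition of $\widehat{\mathbf w}$ as a sum $\widehat{\mathbf w}=\iota\mathbf w_1+\dots+\iota\mathbf w_{\hat l}$ where $\mathbf w_k\in\mathcal V_{A_k\,\mathrm{dist}}$. (iii) Suppose we are given nested Bratteli diagrams, that is, $M\le\widehat M$, and let $\widetilde M$ denote the canonical cover matrix. Suppose $\mathbf w\in\mathcal V_M$. Then there exists a maximal primitive $A\le M$ and $\mathbf v\in\mathcal V_A$ such that $\mathbf v$ is $M/A$-distinguished. Furthermore, $\mathbf v$ is $\widehat M/A$-distinguished iff it is $\widetilde M/A$-distinguished.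
   Context: **Matrices.** A Bratteli diagram is given by finite alphabets $\widehat{\mathcal A}_i$ ($i\ge0$) and a sequence $\widehat M=(\widehat M_i)_{i\ge0}$ of nonnegative integer matrices with rows indexed by $\widehat{\mathcal A}_i$ and columns by $\widehat{\mathcal A}_{i+1}$ (index sets need not be ordered). Reduced: no all-zero rows or columns. $M\le\widehat M$ (a subdiagram, or submatrix sequence) means that the alphabets of $M$ satisfy $\mathcal A_i\subseteq\widehat{\mathcal A}_i$ and $(M_i)_{ab}\le(\widehat M_i)_{ab}$ for all $i$, $a\in\mathcal A_i$, $b\in\mathcal A_{i+1}$. Primitive: for every $k$ there is $n>k$ with $M_kM_{k+1}\cdots M_n$ strictly positive. "Maximal" refers to the order $\le$ on primitive submatrix sequences; "eventually unique" means that any two such sequences agree for all sufficiently large times. The stream of a submatrix sequence is its sequence of subalphabets; streams are disjoint if they are disjoint at each time. **Eigenvector sequences.** For a nonnegative matrix sequence $M$ with alphabets $\mathcal A_i$, $\mathcal V_M^{\mathbf 0}$ is the convex cone of sequences $\mathbf w=(\mathbf w_i)_{i\ge0}$, $\mathbf w_i\in\mathbb R^{\mathcal A_i}$, $\mathbf w_i\ge0$, with $\mathbf w_i=M_i\mathbf w_{i+1}$ for all $i$; $\mathcal V_M$ is the set of those with $\mathbf w_i\ne\mathbf 0$ for every $i$. $\mathrm{Ext}\,\mathcal V_M$ is the set of extreme vectors (nonzero elements of extreme rays) of $\mathcal V_M^{\mathbf 0}$. **Distinguished.** For $M\le\widehat M$, let $\mathtt e$ be the natural embedding of vector sequences indexed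 by $\mathcal A$ into those indexed by $\widehat{\mathcal A}$ (filling in zeros), and $(\widehat M^m\mathbf v)_i=\widehat M_i\widehat M_{i+1}\cdots\widehat M_{i+m-1}\mathbf v_{i+m}$. A sequence $\mathbf w\in\mathcal V_M$ is $\widehat M/M$-distinguished if $\iota(\mathbf w)=\lim_{m\to\infty}\widehat M^m(\mathtt e(\mathbf w))$ exists (coordinatewise at every time). In (ii), $\mathcal V_{A_k\,\mathrm{dist}}$ is the set of $\widehat M/A_k$-distinguished elements of $\mathcal V_{A_k}$. **Canonical cover matrix.** Given $M\le\widehat M$, extend the alphabets of $M$ to those of $\widehat M$ by adding zero entries; then $$\widetilde M_i=\begin{bmatrix}\widehat M_i&\widehat M_i-M_i\\0&M_i\end{bmatrix},$$ with index set two disjoint copies of $\widehat{\mathcal A}_i$. Any $A\le M$ is regarded as satisfying $A\le\widetilde M$ via the lower right block.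
   Formalization: Corrected as follows: primitive submatrices are reduced; "maximal" is up to agreement at all large times; in (ii) the A_k are maximal, their streams disjoint from some time on, and the A_k (and w_k) unique only eventually, up to reindexing (the summands ιw_k exactly). *)

theory Defs
  imports Complex_Main
begin

text \<open>
  The alphabets of a Bratteli diagram are finite subsets of one letter type, which may vary
  with time. Matrices and vectors are total functions that vanish outside the alphabets. Hence two
  matrices over the same alphabets are equal iff the functions are, a matrix or vector
  over subalphabets is also its own extension by zeros to larger alphabets, and the embedding
  of vector sequences along a subdiagram is the identity.
\<close>

datatype 'a diagram =
  Diagram (alph: "nat \<Rightarrow> 'a set") (mat: "nat \<Rightarrow> 'a \<Rightarrow> 'a \<Rightarrow> nat")

type_synonym 'a vseq = "nat \<Rightarrow> 'a \<Rightarrow> real"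

definition bratteli :: "'a diagram \<Rightarrow> bool" where
  "bratteli D \<longleftrightarrow>
     (\<forall>i. finite (alph D i) \<and> alph D i \<noteq> {}) \<and>
     (\<forall>i a b. a \<notin> alph D i \<or> b \<notin> alph D (Suc i) \<longrightarrow> mat D i a b = 0)"

definition reduced :: "'a diagram \<Rightarrow> bool" where
  "reduced D \<longleftrightarrow>
     (\<forall>i. \<forall>a\<in>alph D i. \<exists>b\<in>alph D (Suc i). mat D i a b \<noteq> 0) \<and>
     (\<forall>i. \<forall>b\<in>alph D (Suc i). \<exists>a\<in>alph D i. mat D i a b \<noteq> 0)"

definition bounded_alphabets :: "'a diagram \<Rightarrow> bool" where
  "bounded_alphabets D \<longleftrightarrow> (\<exists>K. \<forall>i. card (alph D i) \<le> K)"

definition subdiagram :: "'a diagram \<Rightarrow> 'a diagram \<Rightarrow> bool" where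
  "subdiagram D E \<longleftrightarrow>
     (\<forall>i. alph D i \<subseteq> alph E i) \<and>
     (\<forall>i. \<forall>a\<in>alph D i. \<forall>b\<in>alph D (Suc i). mat D i a b \<le> mat E i a b)"

text \<open>The product of the \<open>m\<close> factors at times \<open>k, \<dots>, k + m - 1\<close>; rows are
  indexed by the alphabet at time \<open>k\<close>, columns by the alphabet at time \<open>k + m\<close>.\<close>

fun mat_prod :: "'a diagram \<Rightarrow> nat \<Rightarrow> nat \<Rightarrow> 'a \<Rightarrow> 'a \<Rightarrow> nat" where
  "mat_prod D k 0 a b = (if a = b \<and> a \<in> alph D k then 1 else 0)"
| "mat_prod D k (Suc m) a b =
     (\<Sum>c\<in>alph D (k + m). mat_prod D k m a c * mat D (k + m) c b)"

definition primitive :: "'a diagram \<Rightarrow> bool" where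
  "primitive D \<longleftrightarrow>
     (\<forall>k. \<exists>n>k. \<forall>a\<in>alph D k. \<forall>b\<in>alph D (Suc n). mat_prod D k (Suc n - k) a b > 0)"

text \<open>
  Primitive submatrix sequences are taken to be reduced, like all Bratteli diagrams to
  which primitivity is applied. Without zero columns, a product that has become
  strictly positive stays so when further factors are appended.
\<close>

definition primitive_sub :: "'a diagram \<Rightarrow> 'a diagram \<Rightarrow> bool" where
  "primitive_sub E D \<longleftrightarrow> bratteli D \<and> subdiagram D E \<and> reduced D \<and> primitive D"

definition agree_from :: "nat \<Rightarrow> 'a diagram \<Rightarrow> 'a diagram \<Rightarrow> bool" where
  "agree_from N D D' \<longleftrightarrow> (\<forall>i\<ge>N. alph D i = alph D' i \<and> mat D i = mat D' i)"

definition eventually_agree :: "'a diagram \<Rightarrow> 'a diagram \<Rightarrow> bool" where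
  "eventually_agree D D' \<longleftrightarrow> (\<exists>N. agree_from N D D')"

text \<open>
  Maximality for the order \<^const>\<open>subdiagram\<close>, where sequences that agree for all large times
  are identified. Without this identification maximal elements need not exist: for the stationary
  matrix with rows \<open>(2, 0)\<close> and \<open>(1, 1)\<close> over the letters 1 and 2, a primitive subdiagram that
  eventually uses only the letter 1 always has a strictly larger primitive one, which keeps the
  letter 2 for a longer initial stretch of time.
\<close>

definition maximal_primitive :: "'a diagram \<Rightarrow> 'a diagram \<Rightarrow> bool" where
  "maximal_primitive E D \<longleftrightarrow>
     primitive_sub E D \<and>
     (\<forall>D'. primitive_sub E D' \<and> subdiagram D D' \<longrightarrow> eventually_agree D D')"

text \<open>Alphabets are nonempty, so if the alphabet of the ambient diagram at time 0 is a single
  letter, no two streams are disjoint there; hence disjointness is required from some time on.\<close>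

definition eventually_disjoint :: "'a diagram \<Rightarrow> 'a diagram \<Rightarrow> bool" where
  "eventually_disjoint D D' \<longleftrightarrow> (\<exists>N. \<forall>i\<ge>N. alph D i \<inter> alph D' i = {})"

definition eigcone :: "'a diagram \<Rightarrow> 'a vseq set" where
  "eigcone D = {w.
     (\<forall>i a. 0 \<le> w i a) \<and>
     (\<forall>i a. a \<notin> alph D i \<longrightarrow> w i a = 0) \<and>
     (\<forall>i. \<forall>a\<in>alph D i. w i a = (\<Sum>b\<in>alph D (Suc i). real (mat D i a b) * w (Suc i) b))}"

definition eigseqs :: "'a diagram \<Rightarrow> 'a vseq set" where
  "eigseqs D = {w \<in> eigcone D. \<forall>i. \<exists>a\<in>alph D i. w i a \<noteq> 0}"

definition ray :: "'a vseq \<Rightarrow> 'a vseq set" where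
  "ray w = {(\<lambda>i a. c * w i a) | c. 0 \<le> c}"

definition extreme_ray :: "'a vseq set \<Rightarrow> 'a vseq set \<Rightarrow> bool" where
  "extreme_ray C R \<longleftrightarrow>
     (\<exists>w\<in>C. w \<noteq> (\<lambda>i a. 0) \<and> R = ray w) \<and>
     (\<forall>u\<in>C. \<forall>v\<in>C. (\<lambda>i a. u i a + v i a) \<in> R \<longrightarrow> u \<in> R \<and> v \<in> R)"

definition Ext :: "'a diagram \<Rightarrow> 'a vseq set" where
  "Ext D = {w. w \<noteq> (\<lambda>i a. 0) \<and> (\<exists>R. extreme_ray (eigcone D) R \<and> w \<in> R)}"

definition pow_apply :: "'a diagram \<Rightarrow> nat \<Rightarrow> 'a vseq \<Rightarrow> 'a vseq" where
  "pow_apply E m v i a = (\<Sum>b\<in>alph E (i + m). real (mat_prod E i m a b) * v (i + m) b)"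

definition distinguished :: "'a diagram \<Rightarrow> 'a diagram \<Rightarrow> 'a vseq \<Rightarrow> bool" where
  "distinguished E D w \<longleftrightarrow>
     w \<in> eigseqs D \<and> (\<forall>i. \<forall>a\<in>alph E i. convergent (\<lambda>m. pow_apply E m w i a))"

definition iota :: "'a diagram \<Rightarrow> 'a vseq \<Rightarrow> 'a vseq" where
  "iota E w i a = lim (\<lambda>m. pow_apply E m w i a)"

definition stream_decomposition ::
  "'a diagram \<Rightarrow> 'a vseq \<Rightarrow> nat \<Rightarrow> (nat \<Rightarrow> 'a diagram) \<Rightarrow> (nat \<Rightarrow> 'a vseq) \<Rightarrow> bool" where
  "stream_decomposition E v l A w \<longleftrightarrow>
     (\<forall>k<l. maximal_primitive E (A k)) \<and>
     (\<forall>j<l. \<forall>k<l. j \<noteq> k \<longrightarrow> eventually_disjoint (A j) (A k)) \<and>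
     (\<forall>k<l. distinguished E (A k) (w k)) \<and>
     (\<forall>i a. v i a = (\<Sum>k<l. iota E (w k) i a))"

text \<open>In the cover, \<open>Inl\<close> indexes the upper left block and \<open>Inr\<close> the lower right one. The
  subtraction does not truncate when \<open>D\<close> is a subdiagram of \<open>E\<close>.\<close>

fun cover_mat :: "'a diagram \<Rightarrow> 'a diagram \<Rightarrow> nat \<Rightarrow> 'a + 'a \<Rightarrow> 'a + 'a \<Rightarrow> nat" where
  "cover_mat E D i (Inl a) (Inl b) = mat E i a b"
| "cover_mat E D i (Inl a) (Inr b) = mat E i a b - mat D i a b"
| "cover_mat E D i (Inr a) (Inl b) = 0"
| "cover_mat E D i (Inr a) (Inr b) = mat D i a b"

definition canonical_cover :: "'a diagram \<Rightarrow> 'a diagram \<Rightarrow> ('a + 'a) diagram" where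
  "canonical_cover E D = Diagram (\<lambda>i. alph E i <+> alph E i) (cover_mat E D)"

definition lower_vec :: "'a vseq \<Rightarrow> ('a + 'a) vseq" where
  "lower_vec v i = case_sum (\<lambda>_. 0) (v i)"

definition lower_block :: "'a diagram \<Rightarrow> ('a + 'a) diagram" where
  "lower_block A = Diagram (\<lambda>i. Inr ` alph A i)
     (\<lambda>i. case_sum (\<lambda>_ _. 0) (\<lambda>a. case_sum (\<lambda>_. 0) (mat A i a)))"

end

theory Submission
  imports Defs
begin

text \<open>
  Two observations about paths carry the proof. First, if two primitive subdiagrams share a letter at
  infinitely many times, then paths can change from one to the other and their join is primitive.
  So two maximal primitive subdiagrams either agree eventually or are eventually disjoint
  (\<open>maximal_primitive_dichotomy\<close>), and bounded alphabets leave room for only finitely many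
  that are pairwise eventually disjoint. Every primitive
  subdiagram is contained in a maximal one (\<open>maximal_primitive_above\<close>); this needs bounded
  alphabets, since in general the letters that may be added can be chosen ever more generously.

  Second, every \<open>v\<close> in \<open>eigseqs E\<close> gives mass to some primitive subdiagram
  (\<open>primitive_restriction\<close>): the letters reached, within the support of \<open>v\<close>, from a letter
  for which the number of letters reached has the smallest possible limit inferior over time.

  The rest is monotone convergence. For a subdiagram \<open>D\<close> of \<open>E\<close>, the powers of \<open>D\<close> decrease on the
  cone of \<open>E\<close>; their limit, the restriction to \<open>D\<close>, is the largest sequence of \<open>D\<close> below the given
  one. The powers of \<open>E\<close> increase on the cone of \<open>D\<close>; their limit is the extension \<open>iota\<close>. If \<open>v\<close> is
  extreme, then the extension of its restriction to a maximal primitive subdiagram that carries mass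
  is a multiple of \<open>v\<close>, which proves existence in the first part. For general \<open>v\<close>, the
  extensions of its restrictions to the finitely many such subdiagrams add up to at most \<open>v\<close>, because
  streams are eventually disjoint and extensions only depend on large times. A nonzero rest would
  again give mass to one of them, contradicting the choice of the restriction as the largest
  sequence below \<open>v\<close>. So the sum is \<open>v\<close>, and the same two facts force any other decomposition to
  consist of these restrictions. For the cover, the corner of its \<open>m\<close>-th power is the difference of
  the \<open>m\<close>-th powers of the two diagrams, so that, given convergence for the smaller diagram,
  convergence for the cover and for the larger diagram are the same.
\<close>

section \<open>Paths and primitivity\<close>

inductive reach :: "'a diagram \<Rightarrow> nat \<Rightarrow> 'a \<Rightarrow> nat \<Rightarrow> 'a \<Rightarrow> bool" for D m a where
  start: "a \<in> alph D m \<Longrightarrow> reach D m a m a"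
| step: "reach D m a n b \<Longrightarrow> c \<in> alph D (Suc n) \<Longrightarrow> mat D n b c > 0 \<Longrightarrow> reach D m a (Suc n) c"

lemma reach_le: "reach D m a n b \<Longrightarrow> m \<le> n"
  by (induction rule: reach.induct) auto

lemma reach_start_alph: "reach D m a n b \<Longrightarrow> a \<in> alph D m"
  by (induction rule: reach.induct) auto

lemma reach_end_alph: "reach D m a n b \<Longrightarrow> b \<in> alph D n"
  by (induction rule: reach.induct) auto

lemma reach_same_time: "reach D m a m b \<longleftrightarrow> a = b \<and> a \<in> alph D m"
proof
  assume "reach D m a m b"
  then show "a = b \<and> a \<in> alph D m"
  proof cases
    case (step n c)
    then show ?thesis using reach_le[of D m a n c] by simp
  qed auto
qed (auto intro: reach.start)

lemma reach_trans:
  assumes "reach D m a n b" "reach D n b p c"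
  shows "reach D m a p c"
  using assms(2,1) by (induction rule: reach.induct) (auto intro: reach.step)

lemma reach_mono:
  assumes "subdiagram D E" "reach D m a n b"
  shows "reach E m a n b"
  using assms(2)
proof (induction rule: reach.induct)
  case start
  then show ?case using assms(1) by (auto simp: subdiagram_def intro: reach.start)
next
  case (step n b c)
  have "mat D n b c \<le> mat E n b c" "c \<in> alph E (Suc n)"
    using assms(1) step.hyps reach_end_alph[OF step.hyps(1)] by (auto simp: subdiagram_def)
  then show ?case using step by (auto intro: reach.step)
qed

lemma reach_split:
  assumes "reach D m a n b" "m \<le> p" "p \<le> n"
  shows "\<exists>c. reach D m a p c \<and> reach D p c n b"
  using assms
proof (induction rule: reach.induct)
  case start
  then show ?case by (auto intro: reach.start)
next
  case (step n b c)
  show ?case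
  proof (cases "p = Suc n")
    case True
    have "reach D m a (Suc n) c" using step.hyps by (rule reach.step)
    with True step.hyps(2) show ?thesis by (auto intro: reach.start)
  next
    case False
    with step obtain d where "reach D m a p d" "reach D p d n b" by auto
    then show ?thesis using step.hyps(2,3) by (blast intro: reach.step)
  qed
qed

lemma reach_edge:
  "a \<in> alph D n \<Longrightarrow> b \<in> alph D (Suc n) \<Longrightarrow> mat D n a b > 0 \<Longrightarrow> reach D n a (Suc n) b"
  by (rule reach.step[OF reach.start])

lemma reach_edgeD: "reach D n a (Suc n) b \<Longrightarrow> mat D n a b > 0"
  by (erule reach.cases) (auto simp: reach_same_time)

lemma mat_prod_pos_iff:
  assumes "bratteli D"
  shows "mat_prod D k m a b > 0 \<longleftrightarrow> reach D k a (k + m) b"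
proof (induction m arbitrary: b)
  case 0
  then show ?case by (auto simp: reach_same_time)
next
  case (Suc m)
  have fin: "finite (alph D (k + m))" using assms by (simp add: bratteli_def)
  have "mat_prod D k (Suc m) a b > 0 \<longleftrightarrow>
      (\<exists>c\<in>alph D (k + m). mat_prod D k m a c > 0 \<and> mat D (k + m) c b > 0)"
    using fin by (simp add: zero_less_iff_neq_zero del: neq0_conv)
  also have "\<dots> \<longleftrightarrow> (\<exists>c. reach D k a (k + m) c \<and> mat D (k + m) c b > 0)"
    using Suc.IH reach_end_alph[of D k a "k + m"] by blast
  also have "\<dots> \<longleftrightarrow> reach D k a (Suc (k + m)) b"
  proof
    assume "\<exists>c. reach D k a (k + m) c \<and> mat D (k + m) c b > 0"
    then obtain c where c: "reach D k a (k + m) c" "mat D (k + m) c b > 0" by blast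
    have "b \<in> alph D (Suc (k + m))"
      using assms c(2) unfolding bratteli_def by (metis less_irrefl)
    then show "reach D k a (Suc (k + m)) b" using c by (blast intro: reach.step)
  next
    assume "reach D k a (Suc (k + m)) b"
    then show "\<exists>c. reach D k a (k + m) c \<and> mat D (k + m) c b > 0"
      by cases auto
  qed
  finally show ?case by simp
qed

lemma reduced_successor:
  assumes "reduced D" "a \<in> alph D n"
  obtains b where "b \<in> alph D (Suc n)" "mat D n a b > 0"
  using assms unfolding reduced_def by (metis gr0I)

lemma reduced_predecessor:
  assumes "reduced D" "b \<in> alph D (Suc n)"
  obtains a where "a \<in> alph D n" "mat D n a b > 0"
  using assms unfolding reduced_def by (metis gr0I)

lemma reduced_reach_back:
  assumes "reduced D" "b \<in> alph D n" "m \<le> n"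
  shows "\<exists>a. reach D m a n b"
  using assms(3,2)
proof (induction n arbitrary: b rule: dec_induct)
  case base
  then show ?case by (auto intro: reach.start)
next
  case (step n)
  obtain c where c: "c \<in> alph D n" "mat D n c b > 0"
    using reduced_predecessor[OF assms(1) step.prems] .
  with step obtain a where "reach D m a n c" by blast
  then show ?case using c step.prems by (blast intro: reach.step)
qed

text \<open>The products that are positive stay positive because no column vanishes, and a bound that
  works for a single row can be chosen uniformly because alphabets are finite.\<close>

lemma primitive_iff_reach:
  assumes D: "bratteli D" "reduced D"
  shows "primitive D \<longleftrightarrow>
    (\<forall>k. \<forall>a\<in>alph D k. \<exists>n0. \<forall>n\<ge>n0. \<forall>b\<in>alph D n. reach D k a n b)" (is "_ \<longleftrightarrow> ?R")
proof
  assume prim: "primitive D"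
  show ?R
  proof (intro allI ballI)
    fix k a assume a: "a \<in> alph D k"
    obtain n where n: "n > k" "\<forall>a\<in>alph D k. \<forall>b\<in>alph D (Suc n). mat_prod D k (Suc n - k) a b > 0"
      using prim unfolding primitive_def by blast
    have pos: "reach D k a (Suc n) c" if "c \<in> alph D (Suc n)" for c
    proof -
      have "mat_prod D k (Suc n - k) a c > 0" using n(2) a that by blast
      then have "reach D k a (k + (Suc n - k)) c" using mat_prod_pos_iff[OF D(1)] by blast
      then show ?thesis using n(1) by simp
    qed
    have "reach D k a n' b" if n': "n' \<ge> Suc n" "b \<in> alph D n'" for n' b
    proof -
      obtain c where "reach D (Suc n) c n' b" using reduced_reach_back[OF D(2) n'(2,1)] by blast
      from reach_trans[OF pos[OF reach_start_alph[OF this]] this] show ?thesis .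
    qed
    then show "\<exists>n0. \<forall>n\<ge>n0. \<forall>b\<in>alph D n. reach D k a n b" by blast
  qed
next
  assume ?R
  show "primitive D"
    unfolding primitive_def
  proof
    fix k
    have "\<forall>a\<in>alph D k. \<exists>n0. \<forall>n\<ge>n0. \<forall>b\<in>alph D n. reach D k a n b" using \<open>?R\<close> by blast
    from bchoice[OF this]
    obtain f where f: "\<forall>a\<in>alph D k. \<forall>n\<ge>f a. \<forall>b\<in>alph D n. reach D k a n b" by blast
    have fin: "finite (f ` alph D k)" using D(1) by (simp add: bratteli_def)
    define n where "n = Suc (k + Max (insert 0 (f ` alph D k)))"
    have n: "n > k" by (simp add: n_def)
    have "mat_prod D k (Suc n - k) a b > 0" if ab: "a \<in> alph D k" "b \<in> alph D (Suc n)" for a b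
    proof -
      have "f a \<le> Max (insert 0 (f ` alph D k))" using fin ab(1) by (intro Max_ge) auto
      then have "Suc n \<ge> f a" by (simp add: n_def)
      then have "reach D k a (k + (Suc n - k)) b" using f ab n by auto
      then show ?thesis using mat_prod_pos_iff[OF D(1)] by blast
    qed
    then show "\<exists>n>k. \<forall>a\<in>alph D k. \<forall>b\<in>alph D (Suc n). mat_prod D k (Suc n - k) a b > 0"
      using n by blast
  qed
qed

lemma primitive_sub_reach:
  assumes "primitive_sub E D" "a \<in> alph D k"
  obtains n0 where "\<And>n b. n \<ge> n0 \<Longrightarrow> b \<in> alph D n \<Longrightarrow> reach D k a n b"
proof -
  have "bratteli D" "reduced D" "primitive D" using assms(1) by (auto simp: primitive_sub_def)
  then have "\<exists>n0. \<forall>n\<ge>n0. \<forall>b\<in>alph D n. reach D k a n b"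
    using primitive_iff_reach assms(2) by blast
  then show thesis using that by blast
qed

lemma alph_nonempty: "bratteli D \<Longrightarrow> \<exists>a. a \<in> alph D n"
  by (auto simp: bratteli_def)

section \<open>Induced subdiagrams\<close>

definition induced :: "'a diagram \<Rightarrow> (nat \<Rightarrow> 'a set) \<Rightarrow> 'a diagram" where
  "induced E B = Diagram B (\<lambda>i a b. if a \<in> B i \<and> b \<in> B (Suc i) then mat E i a b else 0)"

lemma alph_induced [simp]: "alph (induced E B) = B"
  by (simp add: induced_def)

lemma mat_induced: "mat (induced E B) i a b = (if a \<in> B i \<and> b \<in> B (Suc i) then mat E i a b else 0)"
  by (simp add: induced_def)

lemma bratteli_induced:
  assumes "bratteli E" "\<And>i. B i \<subseteq> alph E i" "\<And>i. B i \<noteq> {}"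
  shows "bratteli (induced E B)"
  using assms finite_subset[OF assms(2)] unfolding bratteli_def by (auto simp: mat_induced)

lemma subdiagram_induced: "(\<And>i. B i \<subseteq> alph E i) \<Longrightarrow> subdiagram (induced E B) E"
  unfolding subdiagram_def by (auto simp: mat_induced)

lemma reach_inducedI:
  assumes "reach E m a n b"
    and "\<And>p c. reach E m a p c \<Longrightarrow> reach E p c n b \<Longrightarrow> c \<in> B p"
  shows "reach (induced E B) m a n b"
  using assms
proof (induction rule: reach.induct)
  case start
  then have "a \<in> B m" using reach.start[of a E m] by blast
  then show ?case by (simp add: reach.start)
next
  case (step n b c)
  have bc: "reach E n b (Suc n) c"
    by (rule reach_edge[OF reach_end_alph[OF step.hyps(1)] step.hyps(2,3)])
  have "reach (induced E B) m a n b"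
    by (rule step.IH) (erule step.prems, erule reach_trans[OF _ bc])
  moreover have "b \<in> B n" using step.prems[OF step.hyps(1) bc] .
  moreover have "c \<in> B (Suc n)"
    by (rule step.prems[OF reach.step[OF step.hyps] reach.start[OF step.hyps(2)]])
  ultimately show ?case
    using step.hyps(3) by (intro reach.step) (auto simp: mat_induced)
qed

section \<open>Maximal primitive subdiagrams\<close>

lemma subdiagram_trans:
  assumes "subdiagram D M" "subdiagram M E"
  shows "subdiagram D E"
  unfolding subdiagram_def
proof (intro conjI allI ballI)
  fix i show "alph D i \<subseteq> alph E i" using assms unfolding subdiagram_def by blast
next
  fix i a b assume "a \<in> alph D i" "b \<in> alph D (Suc i)"
  moreover from this have "a \<in> alph M i" "b \<in> alph M (Suc i)"
    using assms(1) unfolding subdiagram_def by blast+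
  ultimately have "mat D i a b \<le> mat M i a b" "mat M i a b \<le> mat E i a b"
    using assms unfolding subdiagram_def by blast+
  then show "mat D i a b \<le> mat E i a b" by (rule order_trans)
qed

lemma subdiagram_mat_le:
  assumes "bratteli D" "subdiagram D E"
  shows "mat D i a b \<le> mat E i a b"
proof (cases "a \<in> alph D i \<and> b \<in> alph D (Suc i)")
  case True
  then show ?thesis using assms(2) by (simp add: subdiagram_def)
next
  case False
  then have "mat D i a b = 0" using assms(1) by (auto simp: bratteli_def)
  then show ?thesis by simp
qed

lemma eventually_agree_sym: "eventually_agree D D' \<Longrightarrow> eventually_agree D' D"
  unfolding eventually_agree_def agree_from_def by fastforce

lemma eventually_agree_trans:
  assumes "eventually_agree D D'" "eventually_agree D' D''"
  shows "eventually_agree D D''"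
proof -
  obtain N N' where "agree_from N D D'" "agree_from N' D' D''"
    using assms unfolding eventually_agree_def by blast
  then have "agree_from (max N N') D D''" unfolding agree_from_def by simp
  then show ?thesis unfolding eventually_agree_def by blast
qed

text \<open>The maximum of the entries, rather than their sum, keeps the join inside every diagram that
  contains both.\<close>

definition join :: "'a diagram \<Rightarrow> 'a diagram \<Rightarrow> 'a diagram" where
  "join D D' = Diagram (\<lambda>i. alph D i \<union> alph D' i) (\<lambda>i a b. max (mat D i a b) (mat D' i a b))"

lemma subdiagram_join: "subdiagram D (join D D')" "subdiagram D' (join D D')"
  unfolding subdiagram_def join_def by auto

text \<open>At a common letter a path can change from one diagram to the other, so that a letter of
  either diagram eventually leads to all letters of both.\<close>

lemma primitive_sub_join:
  assumes D: "primitive_sub E D" and D': "primitive_sub E D'"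
    and meet: "\<And>N. \<exists>i\<ge>N. alph D i \<inter> alph D' i \<noteq> {}"
  shows "primitive_sub E (join D D')"
proof -
  have br: "bratteli D" "bratteli D'" and sub: "subdiagram D E" "subdiagram D' E"
    and red: "reduced D" "reduced D'"
    using D D' by (auto simp: primitive_sub_def)
  have J: "bratteli (join D D')"
    using br unfolding bratteli_def join_def by auto
  have jsub: "subdiagram (join D D') E"
    using sub subdiagram_mat_le[OF br(1) sub(1)] subdiagram_mat_le[OF br(2) sub(2)]
    unfolding subdiagram_def join_def by auto
  have max_nonzero: "max x y \<noteq> 0 \<longleftrightarrow> x \<noteq> 0 \<or> y \<noteq> 0" for x y :: nat by auto
  have jred: "reduced (join D D')"
    using red unfolding reduced_def join_def diagram.sel max_nonzero by blast
  have crossing: "\<exists>n0. \<forall>n\<ge>n0. \<forall>b\<in>alph F n \<union> alph F' n. reach J k a n b"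
    if F: "primitive_sub E F" "primitive_sub E F'" "subdiagram F J" "subdiagram F' J"
      "\<And>N. \<exists>i\<ge>N. alph F i \<inter> alph F' i \<noteq> {}" and a: "a \<in> alph F k" for F F' J k a
  proof -
    obtain n1 where n1: "\<And>n b. n \<ge> n1 \<Longrightarrow> b \<in> alph F n \<Longrightarrow> reach F k a n b"
      by (rule primitive_sub_reach[OF F(1) a]) (rule that)
    obtain t c where t: "t \<ge> n1" "c \<in> alph F t" "c \<in> alph F' t" using F(5) by blast
    obtain n2 where n2: "\<And>n b. n \<ge> n2 \<Longrightarrow> b \<in> alph F' n \<Longrightarrow> reach F' t c n b"
      by (rule primitive_sub_reach[OF F(2) t(3)]) (rule that)
    have "reach J k a n b" if "n \<ge> max n1 n2" "b \<in> alph F n \<union> alph F' n" for n b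
      using that n1 n2 t reach_mono[OF F(3)] reach_mono[OF F(4)] reach_trans
      by (metis UnE max.bounded_iff)
    then show ?thesis by blast
  qed
  have "primitive (join D D')"
    unfolding primitive_iff_reach[OF J jred]
  proof (intro allI ballI)
    fix k a assume "a \<in> alph (join D D') k"
    then consider "a \<in> alph D k" | "a \<in> alph D' k" unfolding join_def by auto
    then show "\<exists>n0. \<forall>n\<ge>n0. \<forall>b\<in>alph (join D D') n. reach (join D D') k a n b"
    proof cases
      case 1
      then show ?thesis
        using crossing[OF D D' subdiagram_join meet 1] unfolding join_def by simp
    next
      case 2
      have "\<And>N. \<exists>i\<ge>N. alph D' i \<inter> alph D i \<noteq> {}" using meet by (simp add: Int_commute)
      from crossing[OF D' D subdiagram_join(2,1) this 2] show ?thesis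
        unfolding join_def by (simp add: Un_commute)
    qed
  qed
  then show ?thesis using J jsub jred by (simp add: primitive_sub_def)
qed

lemma maximal_primitiveD:
  assumes "maximal_primitive E M"
  shows "bratteli M" "subdiagram M E" "reduced M"
  using assms by (auto simp: maximal_primitive_def primitive_sub_def)

text \<open>Two maximal ones that keep meeting both agree eventually with their join.\<close>

lemma maximal_primitive_dichotomy:
  assumes "maximal_primitive E D" "maximal_primitive E D'"
  shows "eventually_agree D D' \<or> eventually_disjoint D D'"
proof (rule disjCI)
  assume "\<not> eventually_disjoint D D'"
  then have "\<And>N. \<exists>i\<ge>N. alph D i \<inter> alph D' i \<noteq> {}" unfolding eventually_disjoint_def by blast
  then have "primitive_sub E (join D D')"
    using assms by (intro primitive_sub_join) (auto simp: maximal_primitive_def)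
  then have "eventually_agree D (join D D')" "eventually_agree D' (join D D')"
    using assms subdiagram_join unfolding maximal_primitive_def by metis+
  then show "eventually_agree D D'"
    using eventually_agree_sym eventually_agree_trans by metis
qed

lemma eventually_disjoint_sym: "eventually_disjoint D D' \<Longrightarrow> eventually_disjoint D' D"
  unfolding eventually_disjoint_def by (simp add: Int_commute)

lemma eventually_agree_not_disjoint:
  assumes "bratteli D" "eventually_agree D D'"
  shows "\<not> eventually_disjoint D D'"
proof
  assume "eventually_disjoint D D'"
  then obtain N where N: "\<forall>i\<ge>N. alph D i \<inter> alph D' i = {}" unfolding eventually_disjoint_def by blast
  obtain N' where N': "agree_from N' D D'" using assms(2) unfolding eventually_agree_def by blast
  have "alph D (max N N') = {}" using N N' unfolding agree_from_def by (metis Int_absorb max.cobounded1 max.cobounded2)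
  then show False using alph_nonempty[OF assms(1), of "max N N'"] by simp
qed

definition late :: "'a diagram \<Rightarrow> 'a diagram \<Rightarrow> nat \<Rightarrow> nat \<Rightarrow> 'a set" where
  "late E D c n = {b. \<exists>m\<ge>c. \<exists>d\<in>alph D m. reach E m d n b}"

definition returning :: "'a diagram \<Rightarrow> 'a diagram \<Rightarrow> nat \<Rightarrow> 'a set" where
  "returning E D n = {b. \<exists>m. \<exists>d\<in>alph D m. reach E n b m d}"

lemma late_antimono: "c \<le> c' \<Longrightarrow> late E D c' n \<subseteq> late E D c n"
  unfolding late_def by (auto; meson order_trans)

lemma late_reach: "b \<in> late E D c n \<Longrightarrow> reach E n b p x \<Longrightarrow> x \<in> late E D c p"
  unfolding late_def using reach_trans by fast

lemma returning_reach: "x \<in> returning E D p \<Longrightarrow> reach E n b p x \<Longrightarrow> b \<in> returning E D n"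
  unfolding returning_def using reach_trans by fast

text \<open>If a letter at time \<open>n\<close> is reached from \<open>D\<close> at time \<open>c\<close> and not later, then so is every
  letter on the path leading to it. A number \<open>c\<close> for which this happens at arbitrarily large times
  thus accounts for a letter of its own at every time after \<open>c\<close>, and bounded alphabets leave room
  for only finitely many such \<open>c\<close>.\<close>

lemma late_stabilizes:
  assumes E: "bratteli E" and bound: "\<And>i. card (alph E i) \<le> K"
  obtains C where "\<And>c. c \<ge> C \<Longrightarrow> \<exists>N. \<forall>n\<ge>N. late E D c n = late E D C n"
proof -
  define bad where "bad = {c. \<forall>N. \<exists>n\<ge>N. late E D (Suc c) n \<noteq> late E D c n}"
  have own: "\<exists>b. b \<in> late E D c n \<and> b \<notin> late E D (Suc c) n" if c: "c \<in> bad" "c \<le> n" for c n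
  proof -
    obtain n' where n': "n' \<ge> n" "late E D (Suc c) n' \<noteq> late E D c n'"
      using c(1) unfolding bad_def by blast
    then obtain b where b: "b \<in> late E D c n'" "b \<notin> late E D (Suc c) n'"
      using late_antimono[of c "Suc c" E D n'] by auto
    then obtain m d where m: "m \<ge> c" "d \<in> alph D m" "reach E m d n' b" unfolding late_def by blast
    have "m = c" using m b(2) unfolding late_def by (metis (mono_tags, lifting) le_antisym mem_Collect_eq not_less_eq_eq)
    then obtain x where x: "reach E c d n x" "reach E n x n' b"
      using reach_split[OF m(3), of n] n'(1) c(2) by auto
    have "x \<in> late E D c n" using x(1) m(2) \<open>m = c\<close> unfolding late_def by blast
    moreover have "x \<notin> late E D (Suc c) n" using late_reach[OF _ x(2)] b(2) by blast
    ultimately show ?thesis by blast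
  qed
  have "finite bad"
  proof (rule ccontr)
    assume "infinite bad"
    then obtain F where F: "F \<subseteq> bad" "finite F" "card F = Suc K"
      using infinite_arbitrarily_large by metis
    define n where "n = Max (insert 0 F)"
    have "c \<le> n" if "c \<in> F" for c using F(2) that by (simp add: n_def)
    then have "\<forall>c\<in>F. \<exists>b. b \<in> late E D c n \<and> b \<notin> late E D (Suc c) n" using own F(1) by blast
    then obtain f where f: "\<forall>c\<in>F. f c \<in> late E D c n \<and> f c \<notin> late E D (Suc c) n"
      by metis
    have less: "f c \<noteq> f c'" if "c \<in> F" "c' \<in> F" "c < c'" for c c'
      using that f late_antimono[of "Suc c" c' E D n] by (metis Suc_leI subsetD)
    have "inj_on f F"
    proof (rule inj_onI)
      fix x y assume "x \<in> F" "y \<in> F" "f x = f y"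
      then show "x = y" using less[of x y] less[of y x] by (metis nat_neq_iff)
    qed
    moreover have "f ` F \<subseteq> alph E n" using f reach_end_alph unfolding late_def by fast
    moreover have "finite (alph E n)" using E by (simp add: bratteli_def)
    ultimately have "card F \<le> card (alph E n)" by (metis card_inj_on_le)
    then show False using F(3) bound[of n] by simp
  qed
  define C where "C = Suc (Max (insert 0 bad))"
  have nb: "c \<notin> bad" if "c \<ge> C" for c
  proof
    assume "c \<in> bad"
    then have "c \<le> Max (insert 0 bad)" using \<open>finite bad\<close> by simp
    then show False using that unfolding C_def by simp
  qed
  show thesis
  proof
    fix c assume "c \<ge> C"
    then show "\<exists>N. \<forall>n\<ge>N. late E D c n = late E D C n"
    proof (induction c rule: dec_induct)
      case base
      then show ?case by blast
    next
      case (step c)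
      then obtain N where N: "\<forall>n\<ge>N. late E D c n = late E D C n" by blast
      obtain N' where "\<forall>n\<ge>N'. late E D (Suc c) n = late E D c n"
        using nb[OF step.hyps(1)] unfolding bad_def by blast
      with N have "\<forall>n\<ge>max N N'. late E D (Suc c) n = late E D C n" by simp
      then show ?case by blast
    qed
  qed
qed

text \<open>A primitive subdiagram containing \<open>D\<close> consists, from some time on, of letters that lead back
  to \<open>D\<close> and are reached from \<open>D\<close> after any prescribed time. Conversely, by
  the stabilization just proved, a single time bound \<open>C\<close> already forces the
  letters reached from \<open>D\<close> after time \<open>C\<close> to be reached from \<open>D\<close> arbitrarily late, which is
  what primitivity requires. Together with all edges between them these letters therefore form the
  largest primitive extension of \<open>D\<close>, up to finitely many times.\<close>

lemma maximal_primitive_above: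
  assumes E: "bratteli E" "bounded_alphabets E" and D: "primitive_sub E D"
  obtains M where "maximal_primitive E M" "subdiagram D M"
proof -
  have Db: "bratteli D" "subdiagram D E" "reduced D" using D by (auto simp: primitive_sub_def)
  obtain K where K: "\<And>i. card (alph E i) \<le> K" using E(2) unfolding bounded_alphabets_def by blast
  obtain C where C: "\<And>c. c \<ge> C \<Longrightarrow> \<exists>N. \<forall>n\<ge>N. late E D c n = late E D C n"
    using late_stabilizes[OF E(1) K] by blast
  \<comment> \<open>\<open>D\<close> itself has to be added only at times before \<open>C\<close>, when no letter is late.\<close>
  define B where "B n = alph D n \<union> (late E D C n \<inter> returning E D n)" for n
  define M where "M = induced E B"
  have DE: "alph D n \<subseteq> alph E n" for n using Db(2) by (simp add: subdiagram_def)
  have BE: "B n \<subseteq> alph E n" for n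
    using DE reach_end_alph unfolding B_def late_def by fast
  have Bne: "B n \<noteq> {}" for n using alph_nonempty[OF Db(1), of n] unfolding B_def by blast
  have Mb: "bratteli M" unfolding M_def by (rule bratteli_induced[OF E(1) BE Bne])
  have ME: "subdiagram M E" unfolding M_def by (rule subdiagram_induced[OF BE])
  have DM: "subdiagram D M"
    using Db(2) unfolding subdiagram_def M_def B_def by (auto simp: mat_induced)
  have D_ret: "alph D n \<subseteq> returning E D n" for n
    using DE unfolding returning_def by (blast intro: reach.start)
  have D_late: "alph D n \<subseteq> late E D C n" if "n \<ge> C" for n
    using DE that unfolding late_def by (blast intro: reach.start)
  \<comment> \<open>Along a path, being late passes to the later letters and returning to the earlier ones.\<close>
  have path: "reach M m a n b"
    if "reach E m a n b" "a \<in> late E D C m" "b \<in> returning E D n" for m a n b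
    unfolding M_def
  proof (rule reach_inducedI[OF that(1)])
    fix p c assume "reach E m a p c" "reach E p c n b"
    then show "c \<in> B p"
      using late_reach[OF that(2)] returning_reach[OF that(3)] unfolding B_def by blast
  qed
  have Mred: "reduced M"
    unfolding reduced_def
  proof (intro conjI allI ballI)
    fix n a assume a: "a \<in> alph M n"
    show "\<exists>b\<in>alph M (Suc n). mat M n a b \<noteq> 0"
    proof (cases "a \<in> alph D n")
      case True
      obtain b where "b \<in> alph D (Suc n)" "mat D n a b > 0" using reduced_successor[OF Db(3) True] .
      then show ?thesis using DM subdiagram_mat_le[OF Db(1) DM, of n a b]
        unfolding subdiagram_def by (metis le_zero_eq less_irrefl subsetD)
    next
      case False
      then have al: "a \<in> late E D C n" "a \<in> returning E D n" using a unfolding M_def B_def by auto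
      then obtain m d where d: "d \<in> alph D m" "reach E n a m d" unfolding returning_def by blast
      have "n \<noteq> m" using d False by (auto simp: reach_same_time)
      then have "Suc n \<le> m" using reach_le[OF d(2)] by simp
      then obtain b where b: "reach M n a (Suc n) b"
        using reach_split[OF path[OF d(2) al(1)], of "Suc n"] d(1) D_ret by auto
      then show ?thesis using reach_edgeD reach_end_alph by fastforce
    qed
  next
    fix n b assume b: "b \<in> alph M (Suc n)"
    show "\<exists>a\<in>alph M n. mat M n a b \<noteq> 0"
    proof (cases "b \<in> alph D (Suc n)")
      case True
      obtain a where "a \<in> alph D n" "mat D n a b > 0" using reduced_predecessor[OF Db(3) True] .
      then show ?thesis using DM subdiagram_mat_le[OF Db(1) DM, of n a b]
        unfolding subdiagram_def by (metis le_zero_eq less_irrefl subsetD)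
    next
      case False
      then have bl: "b \<in> late E D C (Suc n)" "b \<in> returning E D (Suc n)" using b unfolding M_def B_def by auto
      then obtain m d where d: "m \<ge> C" "d \<in> alph D m" "reach E m d (Suc n) b" unfolding late_def by blast
      have "m \<noteq> Suc n" using d False by (auto simp: reach_same_time)
      then have "m \<le> n" using reach_le[OF d(3)] by simp
      moreover have "reach M m d (Suc n) b" using path[OF d(3) _ bl(2)] D_late[OF d(1)] d(2) by blast
      ultimately obtain a where a: "reach M n a (Suc n) b" using reach_split by (metis le_SucI le_refl)
      then show ?thesis using reach_edgeD reach_start_alph by fastforce
    qed
  qed
  have Mprim: "primitive M"
    unfolding primitive_iff_reach[OF Mb Mred]
  proof (intro allI ballI)
    fix k a assume a: "a \<in> alph M k"
    have "\<exists>m. \<exists>d\<in>alph D m. reach M k a m d"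
    proof (cases "a \<in> alph D k")
      case True
      then show ?thesis using a by (blast intro: reach.start)
    next
      case False
      then have "a \<in> late E D C k" "a \<in> returning E D k" using a unfolding M_def B_def by auto
      then show ?thesis using path D_ret unfolding returning_def by blast
    qed
    then obtain m d where d: "d \<in> alph D m" "reach M k a m d" by blast
    obtain n0 where n0: "\<And>n b. n \<ge> n0 \<Longrightarrow> b \<in> alph D n \<Longrightarrow> reach D m d n b"
      by (rule primitive_sub_reach[OF D d(1)]) (rule that)
    obtain N where N: "\<forall>n\<ge>N. late E D (max C n0) n = late E D C n" using C[of "max C n0"] by auto
    have "reach M k a n b" if n: "n \<ge> max N n0" "b \<in> alph M n" for n b
    proof (cases "b \<in> alph D n")
      case True
      then show ?thesis using n0 n reach_mono[OF DM] reach_trans[OF d(2)] by auto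
    next
      case False
      then have "b \<in> late E D (max C n0) n" "b \<in> returning E D n" using n N unfolding M_def B_def by auto
      then obtain p x where p: "p \<ge> max C n0" "x \<in> alph D p" "reach E p x n b" unfolding late_def by blast
      then have "reach M p x n b" using path D_late \<open>b \<in> returning E D n\<close> by (metis max.bounded_iff subsetD)
      moreover have "reach M m d p x" using n0 p reach_mono[OF DM] by simp
      ultimately show ?thesis using d(2) reach_trans by metis
    qed
    then show "\<exists>n0. \<forall>n\<ge>n0. \<forall>b\<in>alph M n. reach M k a n b" by blast
  qed
  \<comment> \<open>A primitive extension of \<open>M\<close> consists at large times of letters reached from a letter of \<open>D\<close>
    at time \<open>C\<close>, and it leads back to \<open>D\<close>.\<close>
  have "eventually_agree M D'" if D': "primitive_sub E D'" "subdiagram M D'" for D'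
  proof -
    have D'b: "bratteli D'" "subdiagram D' E" using D' by (auto simp: primitive_sub_def)
    have DD': "subdiagram D D'" using DM D'(2) by (rule subdiagram_trans)
    obtain d where d: "d \<in> alph D C" using alph_nonempty[OF Db(1)] by blast
    then have "d \<in> alph D' C" using DD' by (auto simp: subdiagram_def)
    then obtain n0 where n0: "\<And>n b. n \<ge> n0 \<Longrightarrow> b \<in> alph D' n \<Longrightarrow> reach D' C d n b"
      using primitive_sub_reach[OF D'(1)] by blast
    have alph_le: "alph D' n \<subseteq> alph M n" if "n \<ge> n0" for n
    proof
      fix b assume b: "b \<in> alph D' n"
      have "reach E C d n b" using n0[OF that b] reach_mono[OF D'b(2)] by blast
      then have "b \<in> late E D C n" using d unfolding late_def by blast
      moreover obtain n1 where n1: "\<And>n' x. n' \<ge> n1 \<Longrightarrow> x \<in> alph D' n' \<Longrightarrow> reach D' n b n' x"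
        by (rule primitive_sub_reach[OF D'(1) b]) (rule that)
      obtain x where x: "x \<in> alph D n1" using alph_nonempty[OF Db(1)] by blast
      then have "x \<in> alph D' n1" using DD' by (auto simp: subdiagram_def)
      then have "reach E n b n1 x" using n1 reach_mono[OF D'b(2)] by blast
      then have "b \<in> returning E D n" using x unfolding returning_def by blast
      ultimately show "b \<in> alph M n" unfolding M_def B_def by simp
    qed
    have alph_eq: "alph M n = alph D' n" if "n \<ge> n0" for n
      using alph_le[OF that] D'(2) unfolding subdiagram_def by blast
    have "mat M n = mat D' n" if n: "n \<ge> n0" for n
    proof (intro ext)
      fix a b
      show "mat M n a b = mat D' n a b"
      proof (cases "a \<in> alph M n \<and> b \<in> alph M (Suc n)")
        case True
        then have "mat M n a b = mat E n a b" unfolding M_def by (simp add: mat_induced)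
        then show ?thesis
          using subdiagram_mat_le[OF D'b, of n a b] subdiagram_mat_le[OF Mb D'(2), of n a b] by simp
      next
        case False
        then show ?thesis using Mb D'b(1) alph_eq[OF n] alph_eq[of "Suc n"] n
          unfolding bratteli_def by (metis le_SucI)
      qed
    qed
    then show ?thesis using alph_eq unfolding eventually_agree_def agree_from_def by blast
  qed
  then have "maximal_primitive E M"
    using Mb ME Mred Mprim unfolding maximal_primitive_def primitive_sub_def by blast
  then show thesis using DM that by blast
qed

section \<open>Powers applied to vector sequences\<close>

lemma finite_alph: "bratteli D \<Longrightarrow> finite (alph D i)"
  by (simp add: bratteli_def)

lemma mat_outside: "bratteli D \<Longrightarrow> a \<notin> alph D i \<or> b \<notin> alph D (Suc i) \<Longrightarrow> mat D i a b = 0"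
  unfolding bratteli_def by blast

lemma mat_prod_outside:
  assumes "bratteli D" "a \<notin> alph D k"
  shows "mat_prod D k m a b = 0"
  using assms by (induction m arbitrary: b) auto

lemma mat_prod_left:
  assumes D: "bratteli D"
  shows "mat_prod D k (Suc m) a b = (\<Sum>c\<in>alph D (Suc k). mat D k a c * mat_prod D (Suc k) m c b)"
proof (induction m arbitrary: b)
  case 0
  have "mat_prod D k (Suc 0) a b = (\<Sum>c\<in>alph D k. if c = a then mat D k a b else 0)"
    by (simp, rule sum.cong) auto
  also have "\<dots> = mat D k a b"
    using finite_alph[OF D] mat_outside[OF D] by (simp add: sum.delta)
  also have "\<dots> = (\<Sum>c\<in>alph D (Suc k). if c = b then mat D k a c else 0)"
    using finite_alph[OF D] mat_outside[OF D] by (simp add: sum.delta)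
  also have "\<dots> = (\<Sum>c\<in>alph D (Suc k). mat D k a c * mat_prod D (Suc k) 0 c b)"
    by (rule sum.cong) auto
  finally show ?case .
next
  case (Suc m)
  have "mat_prod D k (Suc (Suc m)) a b =
      (\<Sum>d\<in>alph D (k + Suc m). mat_prod D k (Suc m) a d * mat D (k + Suc m) d b)"
    by (rule mat_prod.simps(2))
  also have "\<dots> = (\<Sum>d\<in>alph D (k + Suc m). \<Sum>c\<in>alph D (Suc k).
      mat D k a c * (mat_prod D (Suc k) m c d * mat D (k + Suc m) d b))"
    unfolding Suc.IH sum_distrib_right mult.assoc ..
  also have "\<dots> = (\<Sum>c\<in>alph D (Suc k). \<Sum>d\<in>alph D (k + Suc m).
      mat D k a c * (mat_prod D (Suc k) m c d * mat D (k + Suc m) d b))"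
    by (rule sum.swap)
  also have "\<dots> = (\<Sum>c\<in>alph D (Suc k). mat D k a c * mat_prod D (Suc k) (Suc m) c b)"
    by (simp add: sum_distrib_left)
  finally show ?case .
qed

lemma mat_prod_mono:
  assumes D: "bratteli D" and E: "bratteli E" and sub: "subdiagram D E"
  shows "mat_prod D k m a b \<le> mat_prod E k m a b"
proof (induction m arbitrary: b)
  case 0
  then show ?case using sub by (auto simp: subdiagram_def)
next
  case (Suc m)
  have "(\<Sum>c\<in>alph D (k + m). mat_prod D k m a c * mat D (k + m) c b)
      \<le> (\<Sum>c\<in>alph D (k + m). mat_prod E k m a c * mat E (k + m) c b)"
    using Suc subdiagram_mat_le[OF D sub] by (intro sum_mono mult_le_mono) auto
  also have "\<dots> \<le> (\<Sum>c\<in>alph E (k + m). mat_prod E k m a c * mat E (k + m) c b)"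
    using sub finite_alph[OF E] by (intro sum_mono2) (auto simp: subdiagram_def)
  finally show ?case by simp
qed

lemma pow_apply_outside:
  assumes "bratteli D" "a \<notin> alph D i"
  shows "pow_apply D m v i a = 0"
  unfolding pow_apply_def by (simp add: mat_prod_outside[OF assms])

lemma pow_apply_0:
  assumes "bratteli D"
  shows "pow_apply D 0 v i a = (if a \<in> alph D i then v i a else 0)"
proof -
  have "pow_apply D 0 v i a =
      (\<Sum>b\<in>alph D i. if b = a then (if a \<in> alph D i then v i a else 0) else 0)"
    unfolding pow_apply_def by (rule sum.cong) auto
  then show ?thesis using finite_alph[OF assms] by (simp add: sum.delta)
qed

lemma pow_apply_Suc:
  assumes "bratteli D"
  shows "pow_apply D (Suc m) v i a =
    (\<Sum>c\<in>alph D (Suc i). real (mat D i a c) * pow_apply D m v (Suc i) c)"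
proof -
  have "pow_apply D (Suc m) v i a = (\<Sum>b\<in>alph D (i + Suc m). \<Sum>c\<in>alph D (Suc i).
      real (mat D i a c) * (real (mat_prod D (Suc i) m c b) * v (i + Suc m) b))"
    unfolding pow_apply_def mat_prod_left[OF assms] by (simp add: sum_distrib_right mult.assoc)
  also have "\<dots> = (\<Sum>c\<in>alph D (Suc i). \<Sum>b\<in>alph D (i + Suc m).
      real (mat D i a c) * (real (mat_prod D (Suc i) m c b) * v (i + Suc m) b))"
    by (rule sum.swap)
  finally show ?thesis unfolding pow_apply_def by (simp add: sum_distrib_left)
qed

lemma pow_apply_shift:
  "pow_apply D (Suc m) v i a =
    pow_apply D m (\<lambda>j c. \<Sum>b\<in>alph D (Suc j). real (mat D j c b) * v (Suc j) b) i a"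
proof -
  have "pow_apply D (Suc m) v i a = (\<Sum>b\<in>alph D (Suc (i + m)). \<Sum>c\<in>alph D (i + m).
      real (mat_prod D i m a c) * (real (mat D (i + m) c b) * v (Suc (i + m)) b))"
    unfolding pow_apply_def by (simp add: sum_distrib_right mult.assoc)
  also have "\<dots> = (\<Sum>c\<in>alph D (i + m). \<Sum>b\<in>alph D (Suc (i + m)).
      real (mat_prod D i m a c) * (real (mat D (i + m) c b) * v (Suc (i + m)) b))"
    by (rule sum.swap)
  finally show ?thesis unfolding pow_apply_def by (simp add: sum_distrib_left)
qed

lemma pow_apply_mono:
  assumes "\<And>b. b \<in> alph D (i + m) \<Longrightarrow> u (i + m) b \<le> v (i + m) b"
  shows "pow_apply D m u i a \<le> pow_apply D m v i a"
  unfolding pow_apply_def by (intro sum_mono mult_left_mono assms) auto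

lemma pow_apply_nonneg:
  assumes "\<And>i a. 0 \<le> v i a"
  shows "0 \<le> pow_apply D m v i a"
  unfolding pow_apply_def by (intro sum_nonneg mult_nonneg_nonneg assms) auto

lemma pow_apply_subdiagram:
  assumes "bratteli D" "bratteli E" "subdiagram D E" "\<And>i a. 0 \<le> v i a"
  shows "pow_apply D m v i a \<le> pow_apply E m v i a"
proof -
  have "pow_apply D m v i a \<le> (\<Sum>b\<in>alph D (i + m). real (mat_prod E i m a b) * v (i + m) b)"
    unfolding pow_apply_def
    using mat_prod_mono[OF assms(1-3)] assms(4) by (intro sum_mono mult_right_mono) auto
  also have "\<dots> \<le> pow_apply E m v i a"
    unfolding pow_apply_def
    using assms(3,4) finite_alph[OF assms(2)] by (intro sum_mono2) (auto simp: subdiagram_def)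
  finally show ?thesis .
qed

lemma pow_apply_sum:
  "pow_apply D m (\<lambda>j b. \<Sum>k\<in>I. u k j b) i a = (\<Sum>k\<in>I. pow_apply D m (u k) i a)"
  unfolding pow_apply_def sum_distrib_left by (rule sum.swap)

lemma pow_apply_diff:
  "pow_apply D m (\<lambda>j b. u j b - v j b) i a = pow_apply D m u i a - pow_apply D m v i a"
  unfolding pow_apply_def by (simp add: right_diff_distrib sum_subtractf)

lemma pow_apply_scale: "pow_apply D m (\<lambda>j b. c * v j b) i a = c * pow_apply D m v i a"
  unfolding pow_apply_def by (simp add: sum_distrib_left mult_ac)

section \<open>Eigenvector sequences\<close>

lemma eigcone_nonneg: "w \<in> eigcone D \<Longrightarrow> 0 \<le> w i a"
  by (simp add: eigcone_def)

lemma eigcone_outside: "w \<in> eigcone D \<Longrightarrow> a \<notin> alph D i \<Longrightarrow> w i a = 0"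
  by (simp add: eigcone_def)

lemma eigcone_step:
  "w \<in> eigcone D \<Longrightarrow> a \<in> alph D i \<Longrightarrow>
    w i a = (\<Sum>b\<in>alph D (Suc i). real (mat D i a b) * w (Suc i) b)"
  by (simp add: eigcone_def)

lemma eigseqs_eigcone: "w \<in> eigseqs D \<Longrightarrow> w \<in> eigcone D"
  by (simp add: eigseqs_def)

lemma eigcone_diff:
  assumes "u \<in> eigcone D" "v \<in> eigcone D" "\<And>i a. u i a \<le> v i a"
  shows "(\<lambda>i a. v i a - u i a) \<in> eigcone D"
  using assms unfolding eigcone_def by (simp add: right_diff_distrib sum_subtractf)

lemma eigcone_scale:
  assumes "u \<in> eigcone D" "0 \<le> c"
  shows "(\<lambda>i a. c * u i a) \<in> eigcone D"
  using assms unfolding eigcone_def by (simp add: sum_distrib_left mult_ac)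

lemma pow_apply_eigcone:
  assumes "bratteli D" "w \<in> eigcone D"
  shows "pow_apply D m w i a = w i a"
proof (induction m arbitrary: i a)
  case 0
  then show ?case using pow_apply_0[OF assms(1)] eigcone_outside[OF assms(2)] by simp
next
  case (Suc m)
  show ?case
  proof (cases "a \<in> alph D i")
    case True
    then show ?thesis by (simp add: pow_apply_Suc[OF assms(1)] Suc eigcone_step[OF assms(2) True, symmetric])
  next
    case False
    then show ?thesis using pow_apply_outside[OF assms(1)] eigcone_outside[OF assms(2)] by simp
  qed
qed

lemma pow_apply_below:
  assumes "bratteli E" "v \<in> eigcone E" "\<And>i a. u i a \<le> v i a"
  shows "pow_apply E m u i a \<le> v i a"
  using pow_apply_mono[of E i m u v a] assms(3) pow_apply_eigcone[OF assms(1,2)] by simp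

lemma limit_eigcone:
  assumes D: "bratteli D" and v: "\<And>i a. 0 \<le> v i a"
    and lim: "\<And>i a. (\<lambda>m. pow_apply D m v i a) \<longlonglongrightarrow> w i a"
  shows "w \<in> eigcone D"
proof -
  have "0 \<le> w i a" for i a
    by (rule LIMSEQ_le_const[OF lim]) (auto intro: pow_apply_nonneg v)
  moreover have "w i a = 0" if "a \<notin> alph D i" for i a
    using lim[of i a] pow_apply_outside[OF D that] LIMSEQ_unique[OF _ tendsto_const] by simp
  moreover have "w i a = (\<Sum>b\<in>alph D (Suc i). real (mat D i a b) * w (Suc i) b)" for i a
  proof (rule LIMSEQ_unique)
    show "(\<lambda>m. pow_apply D (Suc m) v i a) \<longlonglongrightarrow> w i a" using lim by (rule LIMSEQ_Suc)
    show "(\<lambda>m. pow_apply D (Suc m) v i a) \<longlonglongrightarrow>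
        (\<Sum>b\<in>alph D (Suc i). real (mat D i a b) * w (Suc i) b)"
      unfolding pow_apply_Suc[OF D] by (intro tendsto_sum tendsto_mult_left lim)
  qed
  ultimately show ?thesis unfolding eigcone_def by blast
qed

text \<open>If a sequence vanishes at one time, then it vanishes at the time before by the eigenvector
  equation, and at the next time because each letter there has an incoming edge, whose source has an
  entry at least as large.\<close>

lemma eigseqsI:
  assumes D: "bratteli D" "reduced D" and w: "w \<in> eigcone D" and ne: "w n a \<noteq> 0"
  shows "w \<in> eigseqs D"
proof -
  define P where "P n \<longleftrightarrow> (\<exists>a\<in>alph D n. w n a \<noteq> 0)" for n
  have up: "P (Suc n)" if "P n" for n
  proof (rule ccontr)
    assume "\<not> P (Suc n)"
    then have "\<forall>b\<in>alph D (Suc n). w (Suc n) b = 0" unfolding P_def by blast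
    then have "w n a = 0" if "a \<in> alph D n" for a using eigcone_step[OF w that] by simp
    then show False using \<open>P n\<close> unfolding P_def by blast
  qed
  have down: "P n" if Suc: "P (Suc n)" for n
  proof -
    obtain b where b: "b \<in> alph D (Suc n)" "w (Suc n) b \<noteq> 0" using Suc unfolding P_def by blast
    obtain a where a: "a \<in> alph D n" "mat D n a b > 0" using reduced_predecessor[OF D(2) b(1)] .
    have "0 < w (Suc n) b" using b(2) eigcone_nonneg[OF w, of "Suc n" b] by linarith
    then have "0 < real (mat D n a b) * w (Suc n) b" using a(2) by simp
    also have "\<dots> \<le> (\<Sum>b\<in>alph D (Suc n). real (mat D n a b) * w (Suc n) b)"
      using b(1) finite_alph[OF D(1)] eigcone_nonneg[OF w] by (intro member_le_sum) auto
    also have "\<dots> = w n a" using eigcone_step[OF w a(1)] by simp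
    finally have "w n a \<noteq> 0" by simp
    then show ?thesis using a(1) unfolding P_def by blast
  qed
  have "P n" using ne eigcone_outside[OF w, of a n] unfolding P_def by blast
  then have "P 0" using down by (induction n) blast+
  then have "P m" for m using up by (induction m) blast+
  then show ?thesis using w unfolding P_def eigseqs_def by blast
qed

section \<open>Restriction to a subdiagram and extension from it\<close>

text \<open>For a subdiagram \<open>D\<close> of \<open>E\<close> and \<open>v\<close> in the cone of \<open>E\<close>, the powers of \<open>D\<close> applied to \<open>v\<close>
  decrease. Hence \<^term>\<open>iota D v\<close> is also meaningful in this direction. If \<open>v\<close> is read as the
  path measure that gives mass \<open>v i a\<close> to the cylinder of each path ending in \<open>a\<close> at time \<open>i\<close>,
  then \<^term>\<open>iota D v\<close> is the mass of those continuations that stay in \<open>D\<close>; in the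
  cone of \<open>D\<close> it is the largest element below \<open>v\<close>.\<close>

context
  fixes D E :: "'a diagram"
  assumes D: "bratteli D" and E: "bratteli E" and sub: "subdiagram D E"
begin

lemma sum_subdiagram_le:
  assumes "\<And>b. 0 \<le> x b"
  shows "(\<Sum>b\<in>alph D (Suc i). real (mat D i a b) * x b) \<le> (\<Sum>b\<in>alph E (Suc i). real (mat E i a b) * x b)"
proof -
  have "(\<Sum>b\<in>alph D (Suc i). real (mat D i a b) * x b) \<le> (\<Sum>b\<in>alph D (Suc i). real (mat E i a b) * x b)"
    using subdiagram_mat_le[OF D sub] assms by (intro sum_mono mult_right_mono) auto
  also have "\<dots> \<le> (\<Sum>b\<in>alph E (Suc i). real (mat E i a b) * x b)"
    using sub finite_alph[OF E] assms by (intro sum_mono2) (auto simp: subdiagram_def)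
  finally show ?thesis .
qed

lemma restriction:
  assumes v: "v \<in> eigcone E"
  shows restriction_tendsto: "(\<lambda>m. pow_apply D m v i a) \<longlonglongrightarrow> iota D v i a"
    and restriction_le: "iota D v i a \<le> v i a"
proof -
  have nn: "0 \<le> v i a" for i a using v by (rule eigcone_nonneg)
  have dec: "decseq (\<lambda>m. pow_apply D m v i a)"
  proof (rule decseq_SucI)
    fix m
    show "pow_apply D (Suc m) v i a \<le> pow_apply D m v i a"
      unfolding pow_apply_shift
    proof (rule pow_apply_mono)
      fix c assume "c \<in> alph D (i + m)"
      then have c: "c \<in> alph E (i + m)" using sub by (auto simp: subdiagram_def)
      then show "(\<Sum>b\<in>alph D (Suc (i + m)). real (mat D (i + m) c b) * v (Suc (i + m)) b) \<le> v (i + m) c"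
        using sum_subdiagram_le[of "v (Suc (i + m))" "i + m" c] nn eigcone_step[OF v c] by simp
    qed
  qed
  have "\<forall>m. 0 \<le> pow_apply D m v i a" by (intro allI pow_apply_nonneg nn)
  then obtain L where L: "(\<lambda>m. pow_apply D m v i a) \<longlonglongrightarrow> L" "\<forall>m. L \<le> pow_apply D m v i a"
    using decseq_convergent[OF dec, of 0] by blast
  then have "iota D v i a = L" unfolding iota_def by (simp add: limI)
  moreover have "L \<le> v i a"
    using L(2)[rule_format, of 0] nn[of i a] by (simp add: pow_apply_0[OF D] split: if_splits)
  ultimately show "(\<lambda>m. pow_apply D m v i a) \<longlonglongrightarrow> iota D v i a" "iota D v i a \<le> v i a"
    using L(1) by auto
qed

lemma restriction_eigcone:
  assumes "v \<in> eigcone E"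
  shows "iota D v \<in> eigcone D"
  by (rule limit_eigcone[OF D]) (rule eigcone_nonneg[OF assms] restriction_tendsto[OF assms])+

lemma restriction_greatest:
  assumes v: "v \<in> eigcone E" and u: "u \<in> eigcone D" and le: "\<And>i a. u i a \<le> v i a"
  shows "u i a \<le> iota D v i a"
proof (rule LIMSEQ_le_const[OF restriction_tendsto[OF v]])
  have "u i a \<le> pow_apply D m v i a" for m
    using pow_apply_mono[of D i m u v a] le pow_apply_eigcone[OF D u] by simp
  then show "\<exists>N. \<forall>n\<ge>N. u i a \<le> pow_apply D n v i a" by blast
qed

text \<open>In the opposite direction, the powers of \<open>E\<close> increase on the cone of \<open>D\<close>, because in terms
  of path measures they add the paths that enter \<open>D\<close> later and later. They converge as soon as
  they are bounded.\<close>

lemma extension_incseq: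
  assumes u: "u \<in> eigcone D"
  shows "incseq (\<lambda>m. pow_apply E m u i a)"
proof (rule incseq_SucI)
  fix m
  show "pow_apply E m u i a \<le> pow_apply E (Suc m) u i a"
    unfolding pow_apply_shift
  proof (rule pow_apply_mono)
    fix c
    show "u (i + m) c \<le> (\<Sum>b\<in>alph E (Suc (i + m)). real (mat E (i + m) c b) * u (Suc (i + m)) b)"
    proof (cases "c \<in> alph D (i + m)")
      case True
      then show ?thesis
        using sum_subdiagram_le[of "u (Suc (i + m))" "i + m" c] eigcone_nonneg[OF u] eigcone_step[OF u True]
        by simp
    next
      case False
      then show ?thesis
        using eigcone_outside[OF u False] eigcone_nonneg[OF u]
        by (auto intro!: sum_nonneg)
    qed
  qed
qed

lemma extension_ge_self:
  assumes u: "u \<in> eigcone D"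
  shows "u i a \<le> pow_apply E m u i a"
proof -
  have "u i a = pow_apply E 0 u i a"
    using eigcone_outside[OF u, of a i] sub by (auto simp: pow_apply_0[OF E] subdiagram_def)
  then show ?thesis using extension_incseq[OF u, of i a] by (simp add: incseq_def)
qed

lemma extension_tendsto:
  assumes "distinguished E D u"
  shows "(\<lambda>m. pow_apply E m u i a) \<longlonglongrightarrow> iota E u i a"
proof (cases "a \<in> alph E i")
  case True
  then show ?thesis
    using assms unfolding distinguished_def iota_def by (simp add: convergent_LIMSEQ_iff)
next
  case False
  then have "pow_apply E m u i a = 0" for m by (rule pow_apply_outside[OF E])
  then show ?thesis unfolding iota_def by (simp add: limI)
qed

lemma extension_eigcone:
  assumes "distinguished E D u"
  shows "iota E u \<in> eigcone E"
proof -
  have "u \<in> eigcone D" using assms by (simp add: distinguished_def eigseqs_def)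
  then show ?thesis
    by (intro limit_eigcone[OF E, of u] eigcone_nonneg extension_tendsto assms)
qed

lemma extension_ge:
  assumes "distinguished E D u"
  shows "u i a \<le> iota E u i a"
proof -
  have "u \<in> eigcone D" using assms by (simp add: distinguished_def eigseqs_def)
  then show ?thesis
    by (intro LIMSEQ_le_const[OF extension_tendsto[OF assms]] exI allI impI extension_ge_self)
qed

lemma distinguishedI:
  assumes u: "u \<in> eigseqs D" and v: "v \<in> eigcone E" and le: "\<And>i a. u i a \<le> v i a"
  shows "distinguished E D u"
  unfolding distinguished_def
proof (intro conjI allI ballI u)
  fix i a
  have "\<forall>m. pow_apply E m u i a \<le> v i a" by (intro allI pow_apply_below E v le)
  then obtain L where "(\<lambda>m. pow_apply E m u i a) \<longlonglongrightarrow> L"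
    using incseq_convergent[OF extension_incseq[OF eigseqs_eigcone[OF u]]] by blast
  then show "convergent (\<lambda>m. pow_apply E m u i a)" by (auto simp: convergent_def)
qed

lemma extension_le:
  assumes "distinguished E D u" "v \<in> eigcone E" "\<And>i a. u i a \<le> v i a"
  shows "iota E u i a \<le> v i a"
  by (intro LIMSEQ_le_const2[OF extension_tendsto[OF assms(1)]] exI allI impI pow_apply_below E assms)

lemma restriction_distinguished:
  assumes "v \<in> eigcone E" "iota D v \<in> eigseqs D"
  shows "distinguished E D (iota D v)"
  using assms restriction_le by (intro distinguishedI) auto

text \<open>The extension of a sequence dominates the sequence, so it vanishes only for the
  sequence zero.\<close>

lemma extension_inj:
  assumes u: "distinguished E D u" and w: "distinguished E D w"
    and le: "\<And>i a. u i a \<le> w i a" and eq: "iota E u = iota E w"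
  shows "u = w"
proof (intro ext)
  fix i a
  have x: "(\<lambda>i a. w i a - u i a) \<in> eigcone D"
    using u w le by (intro eigcone_diff) (auto simp: distinguished_def eigseqs_def)
  have lim: "(\<lambda>m. pow_apply E m (\<lambda>i a. w i a - u i a) i a) \<longlonglongrightarrow> 0"
    unfolding pow_apply_diff
    using tendsto_diff[OF extension_tendsto[OF w] extension_tendsto[OF u], of i a i a] eq by simp
  have "w i a - u i a \<le> 0"
    by (intro LIMSEQ_le_const[OF lim] exI allI impI extension_ge_self[OF x])
  then show "u i a = w i a" using le[of i a] by simp
qed

end

lemma restriction_mono:
  assumes "bratteli D" "bratteli M" "bratteli E" "subdiagram D M" "subdiagram M E" "v \<in> eigcone E"
  shows "iota D v i a \<le> iota M v i a"
proof (rule LIMSEQ_le)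
  show "(\<lambda>m. pow_apply D m v i a) \<longlonglongrightarrow> iota D v i a"
    by (rule restriction_tendsto[OF assms(1,3) subdiagram_trans[OF assms(4,5)] assms(6)])
  show "(\<lambda>m. pow_apply M m v i a) \<longlonglongrightarrow> iota M v i a"
    by (rule restriction_tendsto[OF assms(2,3,5,6)])
  show "\<exists>N. \<forall>n\<ge>N. pow_apply D n v i a \<le> pow_apply M n v i a"
    using pow_apply_subdiagram[OF assms(1,2,4), of v] eigcone_nonneg[OF assms(6)] by blast
qed

lemma eventually_disjoint_family:
  assumes I: "finite I"
    and disj: "\<And>j k. j \<in> I \<Longrightarrow> k \<in> I \<Longrightarrow> j \<noteq> k \<Longrightarrow> eventually_disjoint (A j) (A k)"
  shows "\<exists>N. \<forall>n\<ge>N. \<forall>j\<in>I. \<forall>k\<in>I. j \<noteq> k \<longrightarrow> alph (A j) n \<inter> alph (A k) n = {}"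
proof -
  have "eventually (\<lambda>n. j \<noteq> k \<longrightarrow> alph (A j) n \<inter> alph (A k) n = {}) sequentially"
    if jk: "j \<in> I" "k \<in> I" for j k
  proof (cases "j = k")
    case False
    then show ?thesis
      using disj[OF jk False] unfolding eventually_disjoint_def eventually_sequentially by blast
  qed simp
  then have "eventually (\<lambda>n. \<forall>j\<in>I. \<forall>k\<in>I. j \<noteq> k \<longrightarrow> alph (A j) n \<inter> alph (A k) n = {}) sequentially"
    using I by (intro eventually_ball_finite ballI) auto
  then show ?thesis unfolding eventually_sequentially .
qed

text \<open>Sequences with disjoint supports add up to at most \<open>v\<close> as soon as each of them is below \<open>v\<close>.
  For eventually disjoint streams this is true at large times only, but the extensions are
  determined by large times.\<close>

lemma sum_extension_le:
  assumes E: "bratteli E" and I: "finite I"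
    and A: "\<And>k. k \<in> I \<Longrightarrow> bratteli (A k)" "\<And>k. k \<in> I \<Longrightarrow> subdiagram (A k) E"
    and u: "\<And>k. k \<in> I \<Longrightarrow> distinguished E (A k) (u k)"
    and le: "\<And>k i a. k \<in> I \<Longrightarrow> u k i a \<le> v i a" and v: "v \<in> eigcone E"
    and disj: "\<And>j k. j \<in> I \<Longrightarrow> k \<in> I \<Longrightarrow> j \<noteq> k \<Longrightarrow> eventually_disjoint (A j) (A k)"
  shows "(\<Sum>k\<in>I. iota E (u k) i a) \<le> v i a"
proof -
  obtain N where N: "\<And>n j k. n \<ge> N \<Longrightarrow> j \<in> I \<Longrightarrow> k \<in> I \<Longrightarrow> j \<noteq> k \<Longrightarrow>
      alph (A j) n \<inter> alph (A k) n = {}"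
    using eventually_disjoint_family[OF I, of A] disj by blast
  have out: "u k n b = 0" if "k \<in> I" "b \<notin> alph (A k) n" for k n b
    using u[OF that(1)] that(2) eigcone_outside by (auto simp: distinguished_def eigseqs_def)
  have sum_le: "(\<Sum>k\<in>I. u k n b) \<le> v n b" if n: "n \<ge> N" for n b
  proof (cases "\<exists>k\<in>I. b \<in> alph (A k) n")
    case True
    then obtain j where j: "j \<in> I" "b \<in> alph (A j) n" by blast
    have "(\<Sum>k\<in>I. u k n b) = (\<Sum>k\<in>{j}. u k n b)"
    proof (rule sum.mono_neutral_right)
      show "\<forall>k\<in>I - {j}. u k n b = 0" using N[OF n j(1)] j(2) out by blast
    qed (use I j in auto)
    then show ?thesis using le[OF j(1)] by simp
  next
    case False
    then show ?thesis using out eigcone_nonneg[OF v] by simp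
  qed
  show ?thesis
  proof (rule LIMSEQ_le_const2)
    show "(\<lambda>m. \<Sum>k\<in>I. pow_apply E m (u k) i a) \<longlonglongrightarrow> (\<Sum>k\<in>I. iota E (u k) i a)"
      by (rule tendsto_sum) (rule extension_tendsto[OF A(1) E A(2) u])
    have "(\<Sum>k\<in>I. pow_apply E m (u k) i a) \<le> v i a" if "m \<ge> N" for m
    proof -
      have "(\<Sum>k\<in>I. pow_apply E m (u k) i a) \<le> pow_apply E m v i a"
        unfolding pow_apply_sum[symmetric] using that by (intro pow_apply_mono sum_le) simp
      then show ?thesis using pow_apply_eigcone[OF E v] by simp
    qed
    then show "\<exists>N. \<forall>m\<ge>N. (\<Sum>k\<in>I. pow_apply E m (u k) i a) \<le> v i a" by blast
  qed
qed

section \<open>A primitive subdiagram that carries mass\<close>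

text \<open>Paths are followed inside the support of \<open>v\<close>, where every letter has a successor. The number
  of letters reached from a given letter \<open>a\<close> has a limit inferior over time, and this limit
  inferior does not increase when \<open>a\<close> is replaced by a letter that it reaches. For a letter where
  it is minimal, all letters reached from \<open>a\<close> have the same limit inferior as \<open>a\<close>, so that from
  each of them the same letters are reached at infinitely many times, and hence at all large times.
  The letters reached from \<open>a\<close> therefore form a primitive diagram. No mass is lost on it, because
  it contains every successor in the support of each of its letters. Before the time of \<open>a\<close> it is
  extended by the letters on paths that lead to \<open>a\<close> from one fixed letter at time \<open>0\<close>; columns of
  \<open>E\<close> may vanish, so not every letter need be reached from time \<open>0\<close>.\<close>

lemma primitive_restriction:
  assumes E: "bratteli E" "bounded_alphabets E" and v: "v \<in> eigseqs E"
  obtains D where "primitive_sub E D" "iota D v \<in> eigseqs D"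
proof -
  have vc: "v \<in> eigcone E" using v by (rule eigseqs_eigcone)
  define S where "S n = {a \<in> alph E n. v n a > 0}" for n
  define G where "G = induced E S"
  have alphG: "alph G = S" by (simp add: G_def)
  have Sne: "S n \<noteq> {}" for n
  proof -
    obtain a where "a \<in> alph E n" "v n a \<noteq> 0" using v unfolding eigseqs_def by blast
    then have "a \<in> S n" using eigcone_nonneg[OF vc, of n a] unfolding S_def by simp
    then show ?thesis by blast
  qed
  have SE: "S n \<subseteq> alph E n" for n unfolding S_def by blast
  have Gb: "bratteli G" unfolding G_def by (rule bratteli_induced[OF E(1) SE Sne])
  have GE: "subdiagram G E" unfolding G_def by (rule subdiagram_induced[OF SE])
  have succ: "\<exists>b. reach G n a (Suc n) b" if a: "a \<in> S n" for n a
  proof -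
    have "a \<in> alph E n" "v n a > 0" using a unfolding S_def by auto
    then have "(\<Sum>b\<in>alph E (Suc n). real (mat E n a b) * v (Suc n) b) \<noteq> 0"
      using eigcone_step[OF vc, of a n] by simp
    then obtain b where b: "b \<in> alph E (Suc n)" "real (mat E n a b) * v (Suc n) b \<noteq> 0"
      by (rule sum.not_neutral_contains_not_neutral)
    then have bS: "b \<in> S (Suc n)" using eigcone_nonneg[OF vc, of "Suc n" b] unfolding S_def by auto
    have "mat G n a b > 0" using a bS b(2) unfolding G_def by (simp add: mat_induced)
    then show ?thesis using a bS reach_edge[of a G n b] unfolding alphG by blast
  qed
  have forward: "\<exists>b. reach G m a n b" if "a \<in> S m" "m \<le> n" for m n a
    using that(2)
  proof (induction n rule: dec_induct)
    case base
    then show ?case using that(1) reach.start[of a G m] unfolding alphG by blast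
  next
    case (step n)
    then obtain b where b: "reach G m a n b" by blast
    then have "b \<in> S n" using reach_end_alph[OF b] unfolding alphG by blast
    then show ?case using succ reach_trans[OF b] by blast
  qed
  obtain a0 where a0: "a0 \<in> S 0" using Sne by blast
  define R where "R i a n = {b. reach G i a n b}" for i a n
  have R_fin: "finite (R i a n)" and R_le: "card (R i a n) \<le> card (alph E n)" for i a n
  proof -
    have "R i a n \<subseteq> alph E n" using reach_end_alph SE unfolding R_def alphG[symmetric] by fast
    then show "finite (R i a n)" "card (R i a n) \<le> card (alph E n)"
      using finite_alph[OF E(1)] by (auto intro: finite_subset card_mono)
  qed
  obtain K where K: "\<And>i. card (alph E i) \<le> K" using E(2) unfolding bounded_alphabets_def by blast
  define Q where "Q r \<longleftrightarrow> (\<exists>i a. reach G 0 a0 i a \<and> (\<forall>N. \<exists>n\<ge>N. card (R i a n) \<le> r))" for r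
  have "reach G 0 a0 0 a0" using a0 by (intro reach.start) (simp add: alphG)
  moreover have "\<forall>N. \<exists>n\<ge>N. card (R 0 a0 n) \<le> K" using R_le K order_trans by blast
  ultimately have "Q K" unfolding Q_def by blast
  define r where "r = (LEAST r. Q r)"
  have "Q r" unfolding r_def using \<open>Q K\<close> by (rule LeastI)
  have r_least: "\<not> Q r'" if "r' < r" for r' using that not_less_Least unfolding r_def by blast
  obtain i a where a: "reach G 0 a0 i a" and few: "\<And>N. \<exists>n\<ge>N. card (R i a n) \<le> r"
    using \<open>Q r\<close> unfolding Q_def by blast
  have aS: "a \<in> S i" using reach_end_alph[OF a] by (simp add: alphG)
  \<comment> \<open>By minimality of \<open>r\<close>, a letter reached from \<open>a\<close> eventually reaches at least \<open>r\<close> letters; at a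
    time when \<open>a\<close> reaches at most \<open>r\<close>, these are the same letters.\<close>
  have all: "\<exists>n0. \<forall>n\<ge>n0. \<forall>b\<in>R i a n. reach G j c n b" if c: "reach G i a j c" for j c
  proof -
    have "\<exists>N. \<forall>n\<ge>N. r \<le> card (R j c n)"
    proof (rule ccontr)
      assume "\<not> ?thesis"
      then have small: "\<forall>N. \<exists>n\<ge>N. card (R j c n) < r" by (meson not_le)
      then have "r > 0" by auto
      have "\<forall>N. \<exists>n\<ge>N. card (R j c n) \<le> r - 1"
      proof
        fix N
        obtain n where "n \<ge> N" "card (R j c n) < r" using small by blast
        then show "\<exists>n\<ge>N. card (R j c n) \<le> r - 1" by (intro exI[of _ n]) auto
      qed
      then have "Q (r - 1)" using reach_trans[OF a c] unfolding Q_def by blast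
      then show False using r_least[of "r - 1"] \<open>r > 0\<close> by simp
    qed
    then obtain N where N: "\<And>n. n \<ge> N \<Longrightarrow> r \<le> card (R j c n)" by blast
    obtain t where t: "t \<ge> max N i" "card (R i a t) \<le> r" using few by blast
    have "R j c t \<subseteq> R i a t" using reach_trans[OF c] unfolding R_def by blast
    then have eq: "R j c t = R i a t" using t N[of t] R_fin by (intro card_seteq) auto
    have "reach G j c n b" if n: "n \<ge> t" "b \<in> R i a n" for n b
    proof -
      have "reach G i a n b" using n(2) unfolding R_def by simp
      then obtain x where x: "reach G i a t x" "reach G t x n b"
        using reach_split[of G i a n b t] t(1) n(1) by auto
      then have "reach G j c t x" using eq unfolding R_def by blast
      then show ?thesis using x(2) by (rule reach_trans)
    qed
    then show ?thesis by blast
  qed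
  define B where "B n = {b. reach G 0 a0 n b \<and> (reach G n b i a \<or> reach G i a n b)}" for n
  define D where "D = induced G B"
  have alphD: "alph D = B" by (simp add: D_def)
  have BG: "B n \<subseteq> alph G n" for n using reach_end_alph unfolding B_def by fast
  have after: "c \<in> B n" if "reach G i a n c" for n c
    using that reach_trans[OF a that] unfolding B_def by blast
  have Bne: "B n \<noteq> {}" for n
  proof (cases "n \<le> i")
    case True
    then obtain b where "reach G 0 a0 n b" "reach G n b i a" using reach_split[OF a, of n] by auto
    then show ?thesis unfolding B_def by blast
  next
    case False
    then show ?thesis using forward[OF aS, of n] after by force
  qed
  have Db: "bratteli D" unfolding D_def by (rule bratteli_induced[OF Gb BG Bne])
  have DE: "subdiagram D E"
    using subdiagram_trans[OF subdiagram_induced[of B G] GE] BG unfolding D_def by blast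
  have edge: "b \<in> alph D n \<Longrightarrow> c \<in> alph D (Suc n) \<Longrightarrow> reach G n b (Suc n) c \<Longrightarrow> mat D n b c \<noteq> 0" for n b c
    using reach_edgeD[of G n b c] unfolding D_def by (simp add: mat_induced)
  have Dred: "reduced D"
    unfolding reduced_def
  proof (intro conjI allI ballI)
    fix n b assume b: "b \<in> alph D n"
    have "\<exists>c\<in>B (Suc n). reach G n b (Suc n) c"
    proof (cases "reach G i a n b")
      case True
      have "b \<in> S n" using reach_end_alph[OF True] by (simp add: alphG)
      then obtain c where "reach G n b (Suc n) c" using succ by blast
      then show ?thesis using after reach_trans[OF True] by blast
    next
      case False
      then have b': "reach G n b i a" "reach G 0 a0 n b" using b unfolding alphD B_def by auto
      have "n \<noteq> i" using b'(1) False by (auto simp: reach_same_time)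
      then have "Suc n \<le> i" using reach_le[OF b'(1)] by simp
      then obtain c where c: "reach G n b (Suc n) c" "reach G (Suc n) c i a"
        using reach_split[OF b'(1), of "Suc n"] by auto
      then show ?thesis using reach_trans[OF b'(2) c(1)] unfolding B_def by blast
    qed
    then show "\<exists>c\<in>alph D (Suc n). mat D n b c \<noteq> 0" using edge[OF b] unfolding alphD by blast
  next
    fix n c assume c: "c \<in> alph D (Suc n)"
    have "\<exists>b\<in>B n. reach G n b (Suc n) c"
    proof (cases "reach G (Suc n) c i a")
      case True
      have "reach G 0 a0 (Suc n) c" using c unfolding alphD B_def by blast
      then obtain b where b: "reach G 0 a0 n b" "reach G n b (Suc n) c"
        using reach_split[of G 0 a0 "Suc n" c n] by auto
      then show ?thesis using reach_trans[OF b(2) True] unfolding B_def by blast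
    next
      case False
      then have c': "reach G i a (Suc n) c" using c unfolding alphD B_def by auto
      have "i \<noteq> Suc n" using c' False by (auto simp: reach_same_time)
      then have "i \<le> n" using reach_le[OF c'] by simp
      then obtain b where b: "reach G i a n b" "reach G n b (Suc n) c"
        using reach_split[OF c', of n] by auto
      then show ?thesis using after by blast
    qed
    then show "\<exists>b\<in>alph D n. mat D n b c \<noteq> 0" using edge[OF _ c] unfolding alphD by blast
  qed
  have path_after: "reach D p x q y" if "reach G i a p x" "reach G p x q y" for p x q y
    unfolding D_def
  proof (rule reach_inducedI[OF that(2)])
    fix t c assume "reach G p x t c"
    then show "c \<in> B t" by (rule after[OF reach_trans[OF that(1)]])
  qed
  have path_before: "reach D p x i a" if "reach G 0 a0 p x" "reach G p x i a" for p x
    unfolding D_def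
  proof (rule reach_inducedI[OF that(2)])
    fix t c assume c: "reach G p x t c" "reach G t c i a"
    then show "c \<in> B t" using reach_trans[OF that(1) c(1)] unfolding B_def by blast
  qed
  have a_start: "reach G i a i a" by (rule reach.start) (simp add: alphG aS)
  have late: "b \<in> R i a n" if "b \<in> B n" "n \<ge> i" for n b
  proof (cases "reach G n b i a")
    case True
    then have "n = i" using reach_le[OF True] that(2) by simp
    then show ?thesis using True a_start by (auto simp: reach_same_time R_def)
  next
    case False
    then show ?thesis using that(1) unfolding B_def R_def by blast
  qed
  have from_after: "\<exists>n0. \<forall>n\<ge>n0. \<forall>b\<in>alph D n. reach D k x n b" if x: "reach G i a k x" for k x
  proof -
    obtain n0 where n0: "\<And>n b. n \<ge> n0 \<Longrightarrow> b \<in> R i a n \<Longrightarrow> reach G k x n b" using all[OF x] by blast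
    have "reach D k x n b" if "n \<ge> max n0 i" "b \<in> alph D n" for n b
      using that late[of b n] n0[of n b] path_after[OF x] by (simp add: alphD)
    then show ?thesis by blast
  qed
  have "primitive D"
    unfolding primitive_iff_reach[OF Db Dred]
  proof (intro allI ballI)
    fix k x assume x: "x \<in> alph D k"
    then consider "reach G i a k x" | "reach G 0 a0 k x" "reach G k x i a"
      unfolding alphD B_def by blast
    then show "\<exists>n0. \<forall>n\<ge>n0. \<forall>b\<in>alph D n. reach D k x n b"
    proof cases
      case 1
      then show ?thesis by (rule from_after)
    next
      case 2
      then have xa: "reach D k x i a" by (rule path_before)
      obtain n0 where "\<And>n b. n \<ge> n0 \<Longrightarrow> b \<in> alph D n \<Longrightarrow> reach D i a n b"
        using from_after[OF a_start] by blast
      then show ?thesis using reach_trans[OF xa] by blast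
    qed
  qed
  then have prim: "primitive_sub E D" using Db DE Dred by (simp add: primitive_sub_def)
  \<comment> \<open>Terms of the eigenvector equation of \<open>E\<close> that are missing in \<open>D\<close> vanish, since \<open>D\<close>
    contains all successors in the support.\<close>
  have keep: "(\<Sum>c\<in>alph D (Suc n). real (mat D n b c) * v (Suc n) c) = v n b" if b: "b \<in> B n" "n \<ge> i" for n b
  proof -
    have bi: "reach G i a n b" using late[OF b] unfolding R_def by simp
    have bS: "b \<in> S n" using reach_end_alph[OF bi] by (simp add: alphG)
    have "v n b = (\<Sum>c\<in>alph E (Suc n). real (mat E n b c) * v (Suc n) c)"
      by (rule eigcone_step[OF vc]) (use bS SE in blast)
    also have "\<dots> = (\<Sum>c\<in>B (Suc n). real (mat E n b c) * v (Suc n) c)"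
    proof (rule sum.mono_neutral_right)
      show "\<forall>c\<in>alph E (Suc n) - B (Suc n). real (mat E n b c) * v (Suc n) c = 0"
      proof (rule ballI, rule ccontr)
        fix c assume c: "c \<in> alph E (Suc n) - B (Suc n)" "real (mat E n b c) * v (Suc n) c \<noteq> 0"
        then have cS: "c \<in> S (Suc n)" using eigcone_nonneg[OF vc, of "Suc n" c] unfolding S_def by auto
        have "mat G n b c > 0" using c(2) bS cS unfolding G_def by (simp add: mat_induced)
        then have "reach G n b (Suc n) c" using bS cS by (intro reach_edge) (auto simp: alphG)
        then have "c \<in> B (Suc n)" using after reach_trans[OF bi] by blast
        then show False using c(1) by blast
      qed
      show "B (Suc n) \<subseteq> alph E (Suc n)" using BG SE unfolding alphG by blast
    qed (rule finite_alph[OF E(1)])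
    also have "\<dots> = (\<Sum>c\<in>B (Suc n). real (mat D n b c) * v (Suc n) c)"
    proof (rule sum.cong[OF refl])
      fix c assume "c \<in> B (Suc n)"
      moreover from this have "c \<in> S (Suc n)" using BG unfolding alphG by blast
      ultimately show "real (mat E n b c) * v (Suc n) c = real (mat D n b c) * v (Suc n) c"
        using b(1) bS unfolding D_def G_def by (simp add: mat_induced)
    qed
    finally show ?thesis by (simp add: alphD)
  qed
  have "pow_apply D m v n b = v n b" if "b \<in> B n" "n \<ge> i" for m n b
    using that
  proof (induction m arbitrary: n b)
    case 0
    then show ?case by (simp add: pow_apply_0[OF Db] alphD)
  next
    case (Suc m)
    have "pow_apply D (Suc m) v n b = (\<Sum>c\<in>alph D (Suc n). real (mat D n b c) * v (Suc n) c)"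
      unfolding pow_apply_Suc[OF Db] using Suc by (intro sum.cong) (auto simp: alphD)
    then show ?case using keep[OF Suc.prems] by simp
  qed
  then have "pow_apply D m v i a = v i a" for m using after[OF a_start] by simp
  then have "iota D v i a = v i a" unfolding iota_def by (simp add: limI)
  moreover have "v i a \<noteq> 0" using aS unfolding S_def by simp
  ultimately have "iota D v \<in> eigseqs D"
    using eigseqsI[OF Db Dred restriction_eigcone[OF Db E(1) DE vc], of i a] by simp
  then show thesis using prim that by blast
qed

lemma maximal_primitive_restriction:
  assumes E: "bratteli E" "bounded_alphabets E" and v: "v \<in> eigseqs E"
  obtains M where "maximal_primitive E M" "iota M v \<in> eigseqs M"
proof -
  obtain D where D: "primitive_sub E D" "iota D v \<in> eigseqs D"
    using primitive_restriction[OF E v] .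
  obtain M where M: "maximal_primitive E M" "subdiagram D M"
    using maximal_primitive_above[OF E D(1)] .
  have Mb: "bratteli M" "subdiagram M E" "reduced M" and Db: "bratteli D"
    using M(1) D(1) by (auto simp: maximal_primitive_def primitive_sub_def)
  have vc: "v \<in> eigcone E" using v by (rule eigseqs_eigcone)
  obtain a where "iota D v 0 a \<noteq> 0" using D(2) unfolding eigseqs_def by blast
  then have "0 < iota D v 0 a"
    using eigcone_nonneg[OF eigseqs_eigcone[OF D(2)], of 0 a] by simp
  also have "\<dots> \<le> iota M v 0 a"
    by (rule restriction_mono[OF Db Mb(1) E(1) M(2) Mb(2) vc])
  finally have "iota M v \<in> eigseqs M"
    using eigseqsI[OF Mb(1,3) restriction_eigcone[OF Mb(1) E(1) Mb(2) vc], of 0 a] by simp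
  then show thesis using M(1) that by blast
qed

lemma maximal_primitive_sum_le:
  assumes E: "bratteli E" and I: "finite I" and v: "v \<in> eigcone E"
    and A: "\<And>k. k \<in> I \<Longrightarrow> maximal_primitive E (A k)"
    and u: "\<And>k. k \<in> I \<Longrightarrow> distinguished E (A k) (u k)"
    and le: "\<And>k i a. k \<in> I \<Longrightarrow> u k i a \<le> v i a"
    and disj: "\<And>j k. j \<in> I \<Longrightarrow> k \<in> I \<Longrightarrow> j \<noteq> k \<Longrightarrow> eventually_disjoint (A j) (A k)"
  shows "(\<Sum>k\<in>I. iota E (u k) i a) \<le> v i a"
  by (rule sum_extension_le[OF E I maximal_primitiveD(1)[OF A] maximal_primitiveD(2)[OF A] u le v disj])

section \<open>Extreme sequences\<close>

lemma Ext_eigcone: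
  assumes "v \<in> Ext E"
  shows "v \<in> eigcone E"
proof -
  obtain w c where "w \<in> eigcone E" "v = (\<lambda>i a. c * w i a)" "0 \<le> c"
    using assms unfolding Ext_def extreme_ray_def ray_def by blast
  then show ?thesis using eigcone_scale by blast
qed

text \<open>The witness is \<open>u + (v - u) = v\<close>, a sum of two elements of the cone.\<close>

lemma Ext_below_proportional:
  assumes v: "v \<in> Ext E" and u: "u \<in> eigcone E" "\<And>i a. u i a \<le> v i a" and ne: "u j x \<noteq> 0"
  obtains c where "0 < c" "v = (\<lambda>i a. c * u i a)"
proof -
  obtain w where w: "extreme_ray (eigcone E) (ray w)" "v \<in> ray w"
    using v unfolding Ext_def extreme_ray_def by blast
  have "(\<lambda>i a. v i a - u i a) \<in> eigcone E" by (rule eigcone_diff[OF u(1) Ext_eigcone[OF v] u(2)])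
  moreover have "(\<lambda>i a. u i a + (v i a - u i a)) \<in> ray w" using w(2) by simp
  ultimately have "u \<in> ray w" using w(1) u(1) unfolding extreme_ray_def by blast
  then obtain s t where s: "u = (\<lambda>i a. s * w i a)" "0 \<le> s" and t: "v = (\<lambda>i a. t * w i a)" "0 \<le> t"
    using w(2) unfolding ray_def by blast
  have "s \<noteq> 0" using ne s(1) by auto
  moreover have "t \<noteq> 0" using v t(1) unfolding Ext_def by auto
  ultimately show thesis using s t by (intro that[of "t / s"]) auto
qed

text \<open>The extension of the restriction of \<open>v\<close> is a nonzero element of the cone below \<open>v\<close>, so it
  is \<open>v\<close> up to a positive factor, and the restriction only has to be rescaled.\<close>

lemma Ext_maximal_primitive:
  assumes E: "bratteli E" "reduced E" "bounded_alphabets E" and v: "v \<in> Ext E"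
  obtains M w where "maximal_primitive E M" "distinguished E M w" "v = iota E w"
proof -
  have vc: "v \<in> eigcone E" using v by (rule Ext_eigcone)
  obtain i a where "v i a \<noteq> 0" using v unfolding Ext_def by blast
  then have vs: "v \<in> eigseqs E" using eigseqsI[OF E(1,2) vc] by blast
  obtain M where M: "maximal_primitive E M" "iota M v \<in> eigseqs M"
    using maximal_primitive_restriction[OF E(1,3) vs] .
  note Mb = maximal_primitiveD[OF M(1)]
  define w where "w = iota M v"
  have w: "distinguished E M w" unfolding w_def
    by (rule restriction_distinguished[OF Mb(1) E(1) Mb(2) vc M(2)])
  have u: "iota E w \<in> eigcone E" by (rule extension_eigcone[OF Mb(1) E(1) Mb(2) w])
  have le: "iota E w i a \<le> v i a" for i a
    using extension_le[OF Mb(1) E(1) Mb(2) w vc] restriction_le[OF Mb(1) E(1) Mb(2) vc]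
    unfolding w_def by blast
  obtain x where "w 0 x \<noteq> 0" using M(2) unfolding w_def eigseqs_def by blast
  then have "iota E w 0 x \<noteq> 0"
    using extension_ge[OF Mb(1) E(1) Mb(2) w, of 0 x] eigcone_nonneg[OF eigseqs_eigcone[OF M(2)], of 0 x]
    unfolding w_def by simp
  then obtain c where c: "0 < c" "v = (\<lambda>i a. c * iota E w i a)"
    using Ext_below_proportional[OF v u le] by blast
  define w' where "w' = (\<lambda>i a. c * w i a)"
  have lim: "(\<lambda>m. pow_apply E m w' i a) \<longlonglongrightarrow> v i a" for i a
    unfolding w'_def pow_apply_scale c(2)
    by (intro tendsto_mult_left extension_tendsto[OF Mb(1) E(1) Mb(2) w])
  have "w' \<in> eigseqs M"
    using M(2) eigcone_scale[of w M c] c(1) unfolding w'_def w_def eigseqs_def by auto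
  then have "distinguished E M w'" using lim unfolding distinguished_def convergent_def by blast
  moreover have "v = iota E w'" unfolding iota_def by (intro ext limI[symmetric] lim)
  ultimately show thesis using M(1) that by blast
qed

text \<open>For eventually disjoint streams, the two equal extensions would add up to at most one of
  them and hence vanish.\<close>

lemma maximal_primitive_unique:
  assumes E: "bratteli E" and M: "maximal_primitive E M" "maximal_primitive E M'"
    and w: "distinguished E M w" "distinguished E M' w'" and eq: "iota E w = iota E w'"
  shows "eventually_agree M M'"
proof (rule ccontr)
  assume "\<not> eventually_agree M M'"
  then have disj: "eventually_disjoint M M'" using maximal_primitive_dichotomy[OF M] by blast
  then have disj': "eventually_disjoint M' M" by (rule eventually_disjoint_sym)
  note Mb = maximal_primitiveD[OF M(1)] and Mb' = maximal_primitiveD[OF M(2)]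
  define v where "v = iota E w"
  have v: "v \<in> eigcone E" unfolding v_def by (rule extension_eigcone[OF Mb(1) E Mb(2) w(1)])
  have le: "w i a \<le> v i a" "w' i a \<le> v i a" for i a
    unfolding v_def using extension_ge[OF Mb(1) E Mb(2) w(1)] extension_ge[OF Mb'(1) E Mb'(2) w(2)] eq
    by auto
  have "(\<Sum>k\<in>{True, False}. iota E (if k then w else w') i a) \<le> v i a" for i a
    by (rule maximal_primitive_sum_le[OF E _ v, where A = "\<lambda>k. if k then M else M'"])
      (use M w le disj disj' in auto)
  then have "v i a \<le> 0" for i a
    using eq unfolding v_def by (simp add: add_le_same_cancel1)
  then have "w i a \<le> 0" for i a using le(1) order_trans by blast
  moreover obtain x where "w 0 x \<noteq> 0" using w(1) unfolding distinguished_def eigseqs_def by blast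
  moreover have "0 \<le> w 0 x"
    by (rule eigcone_nonneg[of w M]) (use w(1) in \<open>simp add: distinguished_def eigseqs_def\<close>)
  ultimately show False by (metis order_antisym)
qed

section \<open>Decomposition along maximal primitive streams\<close>

lemma mat_prod_agree:
  assumes "agree_from N D D'" "N \<le> i"
  shows "mat_prod D i m a b = mat_prod D' i m a b"
  using assms by (induction m arbitrary: b) (auto simp: agree_from_def)

lemma iota_agree:
  assumes "agree_from N D D'" "N \<le> i"
  shows "iota D v i a = iota D' v i a"
proof -
  have "alph D (i + m) = alph D' (i + m)" for m using assms by (simp add: agree_from_def)
  then show ?thesis unfolding iota_def pow_apply_def mat_prod_agree[OF assms] by simp
qed

lemma iota_eqI_tail:
  assumes "\<And>i. N \<le> i \<Longrightarrow> u i = w i"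
  shows "iota E u = iota E w"
proof (intro ext)
  fix i a
  have "eventually (\<lambda>m. pow_apply E m u i a = pow_apply E m w i a) sequentially"
    unfolding eventually_sequentially pow_apply_def using assms
    by (intro exI[of _ N]) simp
  then show "iota E u i a = iota E w i a" unfolding iota_def by (rule Lim_cong) simp
qed

lemma stream_decompositionD:
  assumes "stream_decomposition E v l A w"
  shows "\<And>k. k < l \<Longrightarrow> maximal_primitive E (A k)"
    and "\<And>j k. j < l \<Longrightarrow> k < l \<Longrightarrow> j \<noteq> k \<Longrightarrow> eventually_disjoint (A j) (A k)"
    and "\<And>k. k < l \<Longrightarrow> distinguished E (A k) (w k)"
    and "\<And>i a. v i a = (\<Sum>k<l. iota E (w k) i a)"
  using assms unfolding stream_decomposition_def by blast+

text \<open>A component lies below the restriction of \<open>v\<close> to its stream. The extensions of these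
  restrictions still add up to at most \<open>v\<close>, because the streams are eventually disjoint, and
  this leaves no room for a strict inequality.\<close>

lemma stream_decomposition_component:
  assumes E: "bratteli E" and v: "v \<in> eigcone E" and dec: "stream_decomposition E v l A w" and k: "k < l"
  shows "w k = iota (A k) v"
proof -
  note A = stream_decompositionD(1)[OF dec] and disj = stream_decompositionD(2)[OF dec]
    and w = stream_decompositionD(3)[OF dec] and sum = stream_decompositionD(4)[OF dec]
  have ext_eig: "iota E (w j) \<in> eigcone E" if "j < l" for j
    by (rule extension_eigcone[OF maximal_primitiveD(1)[OF A[OF that]] E maximal_primitiveD(2)[OF A[OF that]] w[OF that]])
  have w_cone: "w j \<in> eigcone (A j)" if "j < l" for j
    using w[OF that] by (simp add: distinguished_def eigseqs_def)
  have ext_le_v: "iota E (w j) i a \<le> v i a" if "j < l" for j i a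
    unfolding sum using that eigcone_nonneg[OF ext_eig] by (intro member_le_sum) auto
  define c where "c j = iota (A j) v" for j
  have w_le_v: "w j i a \<le> v i a" if j: "j < l" for j i a
    using extension_ge[OF maximal_primitiveD(1)[OF A[OF j]] E maximal_primitiveD(2)[OF A[OF j]] w[OF j], of i a]
      ext_le_v[OF j, of i a] by simp
  have w_le_c: "w j i a \<le> c j i a" if j: "j < l" for j i a
    unfolding c_def
    by (rule restriction_greatest[OF maximal_primitiveD(1)[OF A[OF j]] E maximal_primitiveD(2)[OF A[OF j]] v w_cone[OF j] w_le_v[OF j]])
  have c_le_v: "c j i a \<le> v i a" if j: "j < l" for j i a
    unfolding c_def
    by (rule restriction_le[OF maximal_primitiveD(1)[OF A[OF j]] E maximal_primitiveD(2)[OF A[OF j]] v])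
  have c: "distinguished E (A j) (c j)" if j: "j < l" for j
  proof -
    note Ab = maximal_primitiveD[OF A[OF j]]
    obtain x where "w j 0 x \<noteq> 0" using w[OF j] unfolding distinguished_def eigseqs_def by blast
    then have "c j 0 x \<noteq> 0" using w_le_c[OF j, of 0 x] eigcone_nonneg[OF w_cone[OF j], of 0 x] by simp
    then have "c j \<in> eigseqs (A j)"
      using eigseqsI[OF Ab(1,3) restriction_eigcone[OF Ab(1) E Ab(2) v]] unfolding c_def by blast
    then show ?thesis unfolding c_def by (rule restriction_distinguished[OF Ab(1) E Ab(2) v])
  qed
  have ext_le: "iota E (w j) i a \<le> iota E (c j) i a" if j: "j < l" for j i a
  proof (rule LIMSEQ_le)
    note Ab = maximal_primitiveD[OF A[OF j]]
    show "(\<lambda>m. pow_apply E m (w j) i a) \<longlonglongrightarrow> iota E (w j) i a"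
      by (rule extension_tendsto[OF Ab(1) E Ab(2) w[OF j]])
    show "(\<lambda>m. pow_apply E m (c j) i a) \<longlonglongrightarrow> iota E (c j) i a"
      by (rule extension_tendsto[OF Ab(1) E Ab(2) c[OF j]])
    show "\<exists>N. \<forall>n\<ge>N. pow_apply E n (w j) i a \<le> pow_apply E n (c j) i a"
      by (intro exI allI impI pow_apply_mono w_le_c j)
  qed
  have "iota E (w k) = iota E (c k)"
  proof (intro ext antisym)
    fix i a
    show "iota E (w k) i a \<le> iota E (c k) i a" by (rule ext_le[OF k])
    have "(\<Sum>j<l. iota E (c j) i a) \<le> v i a"
      by (rule maximal_primitive_sum_le[OF E _ v, where A = A]) (use A c c_le_v disj in auto)
    then have "(\<Sum>j<l. iota E (c j) i a - iota E (w j) i a) \<le> 0"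
      using sum[of i a] by (simp add: sum_subtractf)
    moreover have "iota E (c k) i a - iota E (w k) i a \<le> (\<Sum>j<l. iota E (c j) i a - iota E (w j) i a)"
      using k ext_le by (intro member_le_sum) auto
    ultimately show "iota E (c k) i a \<le> iota E (w k) i a" by simp
  qed
  then have "w k = c k"
    using extension_inj[OF maximal_primitiveD(1)[OF A[OF k]] E maximal_primitiveD(2)[OF A[OF k]] w[OF k] c[OF k] w_le_c[OF k]]
    by blast
  then show ?thesis by (simp add: c_def)
qed

text \<open>Eventually disjoint streams occupy different letters at a common large time, so that
  their number is bounded by the size of the alphabets. A family of maximal primitive streams
  that carry mass of \<open>v\<close>, of the largest possible length, leaves no such stream out. If the extensions of
  its restrictions did not exhaust \<open>v\<close>, then the rest would give mass to some maximal primitive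
  stream, which agrees with a member of the family; but the restriction of \<open>v\<close> to that member
  is already the largest sequence of the stream below \<open>v\<close>.\<close>

lemma stream_decomposition_exists:
  assumes E: "bratteli E" "reduced E" "bounded_alphabets E" and v: "v \<in> eigseqs E"
  obtains l A where "stream_decomposition E v l A (\<lambda>k. iota (A k) v)"
    "\<And>M. maximal_primitive E M \<Longrightarrow> iota M v \<in> eigseqs M \<Longrightarrow> \<exists>k<l. eventually_agree (A k) M"
proof -
  have vc: "v \<in> eigcone E" using v by (rule eigseqs_eigcone)
  obtain K where K: "\<And>i. card (alph E i) \<le> K" using E(3) unfolding bounded_alphabets_def by blast
  define F where "F l A \<longleftrightarrow> (\<forall>k<l. maximal_primitive E (A k) \<and> iota (A k) v \<in> eigseqs (A k)) \<and>
    (\<forall>j<l. \<forall>k<l. j \<noteq> k \<longrightarrow> eventually_disjoint (A j) (A k))" for l and A :: "nat \<Rightarrow> 'a diagram"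
  have F_le: "l \<le> K" if F: "F l A" for l A
  proof -
    have "\<exists>N. \<forall>n\<ge>N. \<forall>j\<in>{..<l}. \<forall>k\<in>{..<l}. j \<noteq> k \<longrightarrow> alph (A j) n \<inter> alph (A k) n = {}"
      by (rule eventually_disjoint_family) (use F in \<open>simp_all add: F_def\<close>)
    then obtain n where n: "\<forall>j\<in>{..<l}. \<forall>k\<in>{..<l}. j \<noteq> k \<longrightarrow> alph (A j) n \<inter> alph (A k) n = {}"
      by blast
    have Ab: "bratteli (A k)" "subdiagram (A k) E" if "k < l" for k
      using F maximal_primitiveD(1,2)[of E "A k"] that unfolding F_def by simp_all
    have "\<forall>k\<in>{..<l}. \<exists>b. b \<in> alph (A k) n" using alph_nonempty[OF Ab(1)] by simp
    from bchoice[OF this] obtain f where f: "\<forall>k\<in>{..<l}. f k \<in> alph (A k) n" by blast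
    have "inj_on f {..<l}"
    proof (rule inj_onI, rule ccontr)
      fix j k assume jk: "j \<in> {..<l}" "k \<in> {..<l}" "f j = f k" "j \<noteq> k"
      then have "f j \<in> alph (A j) n \<inter> alph (A k) n" using bspec[OF f jk(1)] bspec[OF f jk(2)] by simp
      then show False using n jk by blast
    qed
    moreover have "f ` {..<l} \<subseteq> alph E n"
    proof
      fix b assume "b \<in> f ` {..<l}"
      then obtain k where k: "k < l" "b = f k" by blast
      then have "b \<in> alph (A k) n" using f by simp
      then show "b \<in> alph E n" using Ab(2)[OF k(1)] by (auto simp: subdiagram_def)
    qed
    ultimately have "card {..<l} \<le> card (alph E n)" using finite_alph[OF E(1)] by (rule card_inj_on_le)
    then show ?thesis using K[of n] by simp
  qed
  have "\<exists>A. F 0 A" unfolding F_def by simp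
  moreover have "\<forall>l. (\<exists>A. F l A) \<longrightarrow> l \<le> K" using F_le by blast
  ultimately have "\<exists>l. (\<exists>A. F l A) \<and> (\<forall>l'. (\<exists>A. F l' A) \<longrightarrow> l' \<le> l)"
    by (rule Nat.ex_has_greatest_nat)
  then obtain l A where A: "F l A" and l_max: "\<And>l' A'. F l' A' \<Longrightarrow> l' \<le> l" by blast
  have mp: "maximal_primitive E (A k)" and carries: "iota (A k) v \<in> eigseqs (A k)" if "k < l" for k
    using A that unfolding F_def by simp_all
  have disj: "eventually_disjoint (A j) (A k)" if "j < l" "k < l" "j \<noteq> k" for j k
    using A that unfolding F_def by simp
  have complete: "\<exists>k<l. eventually_agree (A k) M"
    if M: "maximal_primitive E M" "iota M v \<in> eigseqs M" for M
  proof (rule ccontr)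
    assume none: "\<not> ?thesis"
    have d: "eventually_disjoint (A k) M" "eventually_disjoint M (A k)" if k: "k < l" for k
    proof -
      show "eventually_disjoint (A k) M" using maximal_primitive_dichotomy[OF mp[OF k] M(1)] none k by blast
      then show "eventually_disjoint M (A k)" by (rule eventually_disjoint_sym)
    qed
    have "F (Suc l) (A(l := M))"
      unfolding F_def
    proof (intro conjI allI impI)
      fix k assume "k < Suc l"
      then show "maximal_primitive E ((A(l := M)) k)" "iota ((A(l := M)) k) v \<in> eigseqs ((A(l := M)) k)"
        using mp carries M by (cases "k = l"; simp)+
    next
      fix j k assume "j < Suc l" "k < Suc l" "j \<noteq> k"
      then show "eventually_disjoint ((A(l := M)) j) ((A(l := M)) k)"
        using d disj by (cases "j = l"; cases "k = l"; simp)
    qed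
    then show False using l_max[of "Suc l"] by simp
  qed
  have dist: "distinguished E (A k) (iota (A k) v)" if "k < l" for k
    using maximal_primitiveD[OF mp[OF that]] E(1) vc carries[OF that] by (intro restriction_distinguished)
  have le_v: "iota (A k) v i a \<le> v i a" if "k < l" for k i a
    using maximal_primitiveD[OF mp[OF that]] E(1) vc by (intro restriction_le)
  have ext: "iota E (iota (A k) v) \<in> eigcone E" if "k < l" for k
    using maximal_primitiveD[OF mp[OF that]] E(1) dist[OF that] by (intro extension_eigcone)
  define s where "s i a = (\<Sum>k<l. iota E (iota (A k) v) i a)" for i a
  have s_le: "s i a \<le> v i a" for i a
    unfolding s_def
    by (rule maximal_primitive_sum_le[OF E(1) _ vc, where A = A]) (use mp dist le_v disj in auto)
  have s: "s \<in> eigcone E"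
    unfolding eigcone_def
  proof (intro CollectI conjI allI impI ballI)
    show "0 \<le> s i a" for i a unfolding s_def by (intro sum_nonneg eigcone_nonneg[OF ext]) simp
    show "s i a = 0" if "a \<notin> alph E i" for i a
      unfolding s_def using eigcone_outside[OF ext that] by simp
    fix i a assume a: "a \<in> alph E i"
    have "s i a = (\<Sum>k<l. \<Sum>b\<in>alph E (Suc i). real (mat E i a b) * iota E (iota (A k) v) (Suc i) b)"
      unfolding s_def by (rule sum.cong[OF refl]) (rule eigcone_step[OF ext a], simp)
    also have "\<dots> = (\<Sum>b\<in>alph E (Suc i). \<Sum>k<l. real (mat E i a b) * iota E (iota (A k) v) (Suc i) b)"
      by (rule sum.swap)
    finally show "s i a = (\<Sum>b\<in>alph E (Suc i). real (mat E i a b) * s (Suc i) b)"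
      unfolding s_def by (simp add: sum_distrib_left)
  qed
  define x where "x = (\<lambda>i a. v i a - s i a)"
  have x: "x \<in> eigcone E" unfolding x_def by (rule eigcone_diff[OF s vc s_le])
  have x_zero: "x i a = 0" for i a
  proof (rule ccontr)
    assume "x i a \<noteq> 0"
    then have "x \<in> eigseqs E" by (rule eigseqsI[OF E(1,2) x])
    then obtain M where M: "maximal_primitive E M" "iota M x \<in> eigseqs M"
      by (rule maximal_primitive_restriction[OF E(1,3)]) (rule that)
    note Mb = maximal_primitiveD[OF M(1)]
    have x_le: "x i a \<le> v i a" for i a using eigcone_nonneg[OF s, of i a] unfolding x_def by simp
    have Mx: "iota M x \<in> eigcone M" and Mv: "iota M v \<in> eigcone M"
      by (rule restriction_eigcone[OF Mb(1) E(1) Mb(2) x], rule restriction_eigcone[OF Mb(1) E(1) Mb(2) vc])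
    have Mx_le: "iota M x i a \<le> x i a" for i a by (rule restriction_le[OF Mb(1) E(1) Mb(2) x])
    have x_M: "iota M x i a \<le> iota M v i a" for i a
      by (rule restriction_greatest[OF Mb(1) E(1) Mb(2) vc Mx order_trans[OF Mx_le x_le]])
    obtain b where b: "iota M x 0 b \<noteq> 0" using M(2) unfolding eigseqs_def by blast
    then have "iota M v 0 b \<noteq> 0" using x_M[of 0 b] eigcone_nonneg[OF Mx, of 0 b] by simp
    then have "iota M v \<in> eigseqs M" by (rule eigseqsI[OF Mb(1,3) Mv])
    then obtain k where k: "k < l" "eventually_agree (A k) M" using complete[OF M(1)] by blast
    then obtain N where N: "agree_from N (A k) M" unfolding eventually_agree_def by blast
    note Ab = maximal_primitiveD[OF mp[OF k(1)]]
    \<comment> \<open>From time \<open>N\<close> on the restrictions to \<open>M\<close> and \<open>A k\<close> coincide, so that both summands fit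
      below \<open>v\<close>: one is part of \<open>s\<close>, the other of the rest \<open>v - s\<close>.\<close>
    have sum_le: "iota M v n b + iota M x n b \<le> v n b" if "n \<ge> N" for n b
    proof -
      have "iota M v n b = iota (A k) v n b" using iota_agree[OF N that, of v b] by simp
      also have "\<dots> \<le> iota E (iota (A k) v) n b" by (rule extension_ge[OF Ab(1) E(1) Ab(2) dist[OF k(1)]])
      also have "\<dots> \<le> s n b" unfolding s_def by (rule member_le_sum) (use k(1) eigcone_nonneg[OF ext] in simp_all)
      finally show ?thesis using Mx_le[of n b] unfolding x_def by simp
    qed
    have "iota M v i a + iota M x i a \<le> iota M v i a" for i a
    proof (rule LIMSEQ_le_const[OF restriction_tendsto[OF Mb(1) E(1) Mb(2) vc]], intro exI allI impI)
      fix m assume m: "m \<ge> N"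
      have "iota M v i a + iota M x i a = pow_apply M m (iota M v) i a + pow_apply M m (iota M x) i a"
        using pow_apply_eigcone[OF Mb(1)] Mv Mx by simp
      also have "\<dots> = pow_apply M m (\<lambda>j b. iota M v j b + iota M x j b) i a"
        unfolding pow_apply_def by (simp add: distrib_left sum.distrib)
      also have "\<dots> \<le> pow_apply M m v i a" using sum_le m by (intro pow_apply_mono) simp
      finally show "iota M v i a + iota M x i a \<le> pow_apply M m v i a" .
    qed
    from this[of 0 b] show False using b eigcone_nonneg[OF Mx, of 0 b] by simp
  qed
  have "stream_decomposition E v l A (\<lambda>k. iota (A k) v)"
    unfolding stream_decomposition_def
    using mp disj dist x_zero unfolding x_def s_def by (auto simp: algebra_simps)
  then show thesis using complete that by blast
qed

text \<open>The components of any decomposition are restrictions of \<open>v\<close>, hence carry mass, and so their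
  streams occur in the complete family. Streams agreeing from some time on have
  restrictions of \<open>v\<close> that agree from the same time on, as the powers at time \<open>i\<close> involve only
  later matrices.\<close>

lemma stream_decomposition_unique:
  assumes E: "bratteli E" and v: "v \<in> eigseqs E"
    and dec: "stream_decomposition E v l A (\<lambda>k. iota (A k) v)"
    and complete: "\<And>M. maximal_primitive E M \<Longrightarrow> iota M v \<in> eigseqs M \<Longrightarrow> \<exists>k<l. eventually_agree (A k) M"
    and dec': "stream_decomposition E v l' A' w'"
  shows "l' = l \<and> (\<exists>\<pi>. bij_betw \<pi> {..<l} {..<l} \<and>
    (\<forall>k<l. eventually_agree (A k) (A' (\<pi> k)) \<and>
       iota E (w' (\<pi> k)) = iota E (iota (A k) v) \<and>
       (\<forall>N. agree_from N (A k) (A' (\<pi> k)) \<longrightarrow> (\<forall>i\<ge>N. w' (\<pi> k) i = iota (A k) v i))))"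
proof -
  have vc: "v \<in> eigcone E" using v by (rule eigseqs_eigcone)
  note A = stream_decompositionD(1)[OF dec] and A' = stream_decompositionD(1)[OF dec']
  have w': "w' k = iota (A' k) v" if "k < l'" for k
    by (rule stream_decomposition_component[OF E vc dec' that])
  have "\<forall>k\<in>{..<l'}. \<exists>j. j < l \<and> eventually_agree (A j) (A' k)"
  proof
    fix k assume "k \<in> {..<l'}"
    then have k: "k < l'" by simp
    have "iota (A' k) v \<in> eigseqs (A' k)"
      using stream_decompositionD(3)[OF dec' k] unfolding w'[OF k] distinguished_def by blast
    then show "\<exists>j. j < l \<and> eventually_agree (A j) (A' k)" using complete[OF A'[OF k]] by blast
  qed
  from bchoice[OF this] obtain \<sigma>
    where \<sigma>: "\<And>k. k < l' \<Longrightarrow> \<sigma> k < l" "\<And>k. k < l' \<Longrightarrow> eventually_agree (A (\<sigma> k)) (A' k)" by auto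
  have inj: "inj_on \<sigma> {..<l'}"
  proof (rule inj_onI, rule ccontr)
    fix j k assume jk: "j \<in> {..<l'}" "k \<in> {..<l'}" "\<sigma> j = \<sigma> k" "j \<noteq> k"
    then have "eventually_agree (A' j) (A' k)"
      using \<sigma>(2)[of j] \<sigma>(2)[of k] eventually_agree_sym eventually_agree_trans by fastforce
    moreover have "eventually_disjoint (A' j) (A' k)" using stream_decompositionD(2)[OF dec'] jk by simp
    ultimately show False
      using eventually_agree_not_disjoint maximal_primitiveD(1)[OF A'[of j]] jk(1) by blast
  qed
  have surj: "\<exists>k<l'. \<sigma> k = j" if j: "j < l" for j
  proof (rule ccontr)
    \<comment> \<open>Otherwise \<open>A j\<close> could be added to the second decomposition, whose sum is already \<open>v\<close>.\<close>
    assume none: "\<not> ?thesis"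
    have dj: "eventually_disjoint (A j) (A' k)" "eventually_disjoint (A' k) (A j)" if k: "k < l'" for k
    proof -
      have "\<sigma> k \<noteq> j" using none k by blast
      then have "eventually_disjoint (A j) (A (\<sigma> k))"
        using stream_decompositionD(2)[OF dec j \<sigma>(1)[OF k]] by blast
      then have "\<not> eventually_agree (A j) (A' k)"
        using \<sigma>(2)[OF k] eventually_agree_sym eventually_agree_trans
          eventually_agree_not_disjoint[OF maximal_primitiveD(1)[OF A[OF j]]] by blast
      then show "eventually_disjoint (A j) (A' k)" "eventually_disjoint (A' k) (A j)"
        using maximal_primitive_dichotomy[OF A[OF j] A'[OF k]]
        unfolding eventually_disjoint_def by (auto simp: Int_commute)
    qed
    define B where "B = A'(l' := A j)"
    define u where "u = w'(l' := iota (A j) v)"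
    have B: "maximal_primitive E (B k)" and u: "distinguished E (B k) (u k)" if "k < Suc l'" for k
      using that A' A[OF j] stream_decompositionD(3)[OF dec'] stream_decompositionD(3)[OF dec j]
      unfolding B_def u_def by (auto simp: less_Suc_eq)
    have u_eq: "u k = iota (B k) v" if "k < Suc l'" for k
      using that w' unfolding B_def u_def by (auto simp: less_Suc_eq)
    have u_le: "u k i a \<le> v i a" if "k < Suc l'" for k i a
      unfolding u_eq[OF that] using maximal_primitiveD[OF B[OF that]] E vc by (intro restriction_le)
    have "(\<Sum>k<Suc l'. iota E (u k) i a) \<le> v i a" for i a
      by (rule maximal_primitive_sum_le[OF E _ vc, where A = B])
        (use B u u_le dj stream_decompositionD(2)[OF dec'] in \<open>auto simp: B_def less_Suc_eq\<close>)
    moreover have "(\<Sum>k<Suc l'. iota E (u k) i a) = v i a + iota E (iota (A j) v) i a" for i a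
      unfolding stream_decompositionD(4)[OF dec', of i a] by (simp add: u_def)
    ultimately have le0: "iota E (iota (A j) v) i a \<le> 0" for i a
      using add_le_same_cancel1 by metis
    note Ab = maximal_primitiveD[OF A[OF j]] and dj' = stream_decompositionD(3)[OF dec j]
    obtain x where "iota (A j) v 0 x \<noteq> 0" using dj' unfolding distinguished_def eigseqs_def by blast
    moreover have "0 \<le> iota (A j) v 0 x"
      using dj' eigcone_nonneg[of "iota (A j) v" "A j"] unfolding distinguished_def eigseqs_def by blast
    ultimately show False
      using extension_ge[OF Ab(1) E Ab(2) dj', of 0 x] le0[of 0 x] by simp
  qed
  have bij: "bij_betw \<sigma> {..<l'} {..<l}"
    using inj surj \<sigma>(1) unfolding bij_betw_def by (auto simp: image_iff)
  have l: "l' = l" using bij_betw_same_card[OF bij] by simp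
  define \<pi> where "\<pi> = inv_into {..<l} \<sigma>"
  have \<pi>: "bij_betw \<pi> {..<l} {..<l}" unfolding \<pi>_def using bij_betw_inv_into[OF bij] l by simp
  have "eventually_agree (A k) (A' (\<pi> k)) \<and> iota E (w' (\<pi> k)) = iota E (iota (A k) v) \<and>
      (\<forall>N. agree_from N (A k) (A' (\<pi> k)) \<longrightarrow> (\<forall>i\<ge>N. w' (\<pi> k) i = iota (A k) v i))" if k: "k < l" for k
  proof -
    have pk: "\<pi> k < l'" using \<pi> k l unfolding bij_betw_def by auto
    have "\<sigma> (\<pi> k) = k"
      unfolding \<pi>_def using bij_betw_inv_into_right[OF bij, of k] k l by simp
    then have ag: "eventually_agree (A k) (A' (\<pi> k))" using \<sigma>(2)[OF pk] by simp
    have tail: "w' (\<pi> k) i = iota (A k) v i" if "agree_from N (A k) (A' (\<pi> k))" "i \<ge> N" for N i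
      unfolding w'[OF pk] using iota_agree[OF that] by (intro ext) simp
    obtain N where "agree_from N (A k) (A' (\<pi> k))" using ag unfolding eventually_agree_def by blast
    then have "iota E (w' (\<pi> k)) = iota E (iota (A k) v)" using tail by (intro iota_eqI_tail)
    then show ?thesis using ag tail by blast
  qed
  then show ?thesis using l \<pi> by blast
qed

section \<open>The canonical cover\<close>

lemma eigseqs_lower_block:
  assumes "v \<in> eigseqs A"
  shows "lower_vec v \<in> eigseqs (lower_block A)"
proof -
  have v: "\<And>i a. 0 \<le> v i a" "\<And>i a. a \<notin> alph A i \<Longrightarrow> v i a = 0"
    by (rule eigcone_nonneg[OF eigseqs_eigcone[OF assms]])
      (rule eigcone_outside[OF eigseqs_eigcone[OF assms]])
  have "lower_vec v i x = (\<Sum>y\<in>alph (lower_block A) (Suc i). real (mat (lower_block A) i x y) * lower_vec v (Suc i) y)"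
    if "x \<in> alph (lower_block A) i" for i x
  proof -
    obtain a where a: "x = Inr a" "a \<in> alph A i" using \<open>x \<in> _\<close> by (auto simp: lower_block_def)
    have "v i a = (\<Sum>b\<in>alph A (Suc i). real (mat A i a b) * v (Suc i) b)"
      by (rule eigcone_step[OF eigseqs_eigcone[OF assms] a(2)])
    then show ?thesis by (simp add: a lower_vec_def lower_block_def sum.reindex)
  qed
  moreover have "0 \<le> lower_vec v i x" for i x using v(1) by (cases x) (auto simp: lower_vec_def)
  moreover have "lower_vec v i x = 0" if "x \<notin> alph (lower_block A) i" for i x
    using v(2) that by (cases x) (auto simp: lower_vec_def lower_block_def)
  ultimately have "lower_vec v \<in> eigcone (lower_block A)" unfolding eigcone_def by blast
  moreover have "\<exists>x\<in>alph (lower_block A) i. lower_vec v i x \<noteq> 0" for i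
    using assms by (auto simp: eigseqs_def lower_vec_def lower_block_def)
  ultimately show ?thesis unfolding eigseqs_def by blast
qed

context
  fixes E M :: "'a diagram"
  assumes E: "bratteli E" and M: "bratteli M" and sub: "subdiagram M E"
begin

lemma bratteli_canonical_cover: "bratteli (canonical_cover E M)"
  unfolding bratteli_def
proof (intro conjI allI impI)
  fix i
  show "finite (alph (canonical_cover E M) i)" "alph (canonical_cover E M) i \<noteq> {}"
    using finite_alph[OF E] alph_nonempty[OF E] by (auto simp: canonical_cover_def)
next
  fix i x y assume out: "x \<notin> alph (canonical_cover E M) i \<or> y \<notin> alph (canonical_cover E M) (Suc i)"
  show "mat (canonical_cover E M) i x y = 0"
  proof -
    have zero: "mat E i a b = 0 \<and> mat M i a b = 0" if "a \<notin> alph E i \<or> b \<notin> alph E (Suc i)" for a b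
      using mat_outside[OF E that] subdiagram_mat_le[OF M sub, of i a b] by simp
    from out show ?thesis
      by (elim disjE; cases x; cases y) (simp_all add: canonical_cover_def Plus_def image_iff zero)
  qed
qed

text \<open>The powers of the cover are block triangular as well, with the powers of \<open>E\<close> and \<open>M\<close> on the
  diagonal and their difference in the corner: by induction,
  \<open>E (E^m - M^m) + (E - M) M^m = E^(m+1) - M^(m+1)\<close>.\<close>

lemma pow_apply_cover:
  assumes v: "\<And>i a. a \<notin> alph M i \<Longrightarrow> v i a = 0"
  shows "pow_apply (canonical_cover E M) m (lower_vec v) i (Inr a) = pow_apply M m v i a"
    and "pow_apply (canonical_cover E M) m (lower_vec v) i (Inl a) = pow_apply E m v i a - pow_apply M m v i a"
proof (induction m arbitrary: i a)
  case 0
  have "a \<in> alph M i \<Longrightarrow> a \<in> alph E i" for i a using sub by (auto simp: subdiagram_def)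
  then show "pow_apply (canonical_cover E M) 0 (lower_vec v) i (Inr a) = pow_apply M 0 v i a"
    "pow_apply (canonical_cover E M) 0 (lower_vec v) i (Inl a) = pow_apply E 0 v i a - pow_apply M 0 v i a" for i a
    unfolding pow_apply_0[OF bratteli_canonical_cover] pow_apply_0[OF E] pow_apply_0[OF M]
    using v by (auto simp: lower_vec_def canonical_cover_def)
next
  case (Suc m)
  define C where "C = canonical_cover E M"
  have Cb: "bratteli C" unfolding C_def by (rule bratteli_canonical_cover)
  have mC: "mat C = cover_mat E M" and aC: "alph C i = alph E i <+> alph E i" for i
    by (auto simp: C_def canonical_cover_def)
  have M_sum: "(\<Sum>b\<in>alph E (Suc i). real (mat M i a b) * pow_apply M m v (Suc i) b) = pow_apply M (Suc m) v i a" for i a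
    unfolding pow_apply_Suc[OF M]
    using sub finite_alph[OF E] mat_outside[OF M]
    by (intro sum.mono_neutral_right) (auto simp: subdiagram_def)
  have IH: "pow_apply C m (lower_vec v) i (Inr a) = pow_apply M m v i a"
    "pow_apply C m (lower_vec v) i (Inl a) = pow_apply E m v i a - pow_apply M m v i a" for i a
    unfolding C_def by (rule Suc.IH)+
  have split: "pow_apply C (Suc m) (lower_vec v) i x =
      (\<Sum>b\<in>alph E (Suc i). real (mat C i x (Inl b)) * (pow_apply E m v (Suc i) b - pow_apply M m v (Suc i) b)) +
      (\<Sum>b\<in>alph E (Suc i). real (mat C i x (Inr b)) * pow_apply M m v (Suc i) b)" for i x
    unfolding pow_apply_Suc[OF Cb] aC
    using finite_alph[OF E] by (simp add: sum.Plus IH)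
  show "pow_apply (canonical_cover E M) (Suc m) (lower_vec v) i (Inr a) = pow_apply M (Suc m) v i a" for i a
    using split[of i "Inr a"] M_sum[of i a] unfolding C_def[symmetric] mC by simp
  show "pow_apply (canonical_cover E M) (Suc m) (lower_vec v) i (Inl a) =
      pow_apply E (Suc m) v i a - pow_apply M (Suc m) v i a" for i a
  proof -
    have "pow_apply C (Suc m) (lower_vec v) i (Inl a) =
      (\<Sum>b\<in>alph E (Suc i). real (mat E i a b) * (pow_apply E m v (Suc i) b - pow_apply M m v (Suc i) b) +
        (real (mat E i a b) - real (mat M i a b)) * pow_apply M m v (Suc i) b)"
      unfolding split mC sum.distrib[symmetric]
      using subdiagram_mat_le[OF M sub] by (simp add: of_nat_diff)
    also have "\<dots> = (\<Sum>b\<in>alph E (Suc i). real (mat E i a b) * pow_apply E m v (Suc i) b) -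
        (\<Sum>b\<in>alph E (Suc i). real (mat M i a b) * pow_apply M m v (Suc i) b)"
      unfolding sum_subtractf[symmetric] by (simp add: algebra_simps)
    finally show ?thesis unfolding M_sum pow_apply_Suc[OF E] C_def .
  qed
qed

lemma distinguished_cover_iff:
  assumes A: "subdiagram A M" and v: "distinguished M A v"
  shows "distinguished E A v \<longleftrightarrow> distinguished (canonical_cover E M) (lower_block A) (lower_vec v)"
proof -
  have vs: "v \<in> eigseqs A" using v by (simp add: distinguished_def)
  have out: "v i a = 0" if "a \<notin> alph M i" for i a
    using eigcone_outside[OF eigseqs_eigcone[OF vs], of a i] A that by (auto simp: subdiagram_def)
  note cover = pow_apply_cover[of v, OF out]
  have conv: "convergent (\<lambda>m. pow_apply M m v i a)" for i a
  proof (cases "a \<in> alph M i")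
    case True
    then show ?thesis using v by (simp add: distinguished_def)
  next
    case False
    then show ?thesis by (simp add: pow_apply_outside[OF M False] convergent_const)
  qed
  have diff: "convergent (\<lambda>m. pow_apply E m v i a - pow_apply M m v i a) \<longleftrightarrow> convergent (\<lambda>m. pow_apply E m v i a)" for i a
    using convergent_add[OF _ conv[of i a], of "\<lambda>m. pow_apply E m v i a - pow_apply M m v i a"]
      convergent_diff[OF _ conv[of i a], of "\<lambda>m. pow_apply E m v i a"] by auto
  have "alph (canonical_cover E M) i = alph E i <+> alph E i" for i
    by (simp add: canonical_cover_def)
  then have "(\<forall>x\<in>alph (canonical_cover E M) i.
        convergent (\<lambda>m. pow_apply (canonical_cover E M) m (lower_vec v) i x)) \<longleftrightarrow>
      (\<forall>a\<in>alph E i. convergent (\<lambda>m. pow_apply E m v i a))" for i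
    by (simp add: Plus_def ball_Un cover diff conv)
  then show ?thesis
    using vs eigseqs_lower_block[OF vs] unfolding distinguished_def by blast
qed

end

section \<open>The decomposition theorem\<close>

theorem theorem4p27:
  fixes Mhat :: "'a diagram"
  assumes "bratteli Mhat" and "reduced Mhat" and "bounded_alphabets Mhat"
  shows
    "(\<forall>what\<in>Ext Mhat.
        (\<exists>M. maximal_primitive Mhat M \<and>
             (\<exists>w\<in>eigseqs M. distinguished Mhat M w \<and> what = iota Mhat w)) \<and>
        (\<forall>M M'.
           maximal_primitive Mhat M \<and>
             (\<exists>w\<in>eigseqs M. distinguished Mhat M w \<and> what = iota Mhat w) \<and>
           maximal_primitive Mhat M' \<and>
             (\<exists>w\<in>eigseqs M'. distinguished Mhat M' w \<and> what = iota Mhat w)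
           \<longrightarrow> eventually_agree M M'))
     \<and>
     (\<forall>what\<in>eigseqs Mhat. \<exists>l A w.
        stream_decomposition Mhat what l A w \<and>
        (\<forall>l' A' w'. stream_decomposition Mhat what l' A' w' \<longrightarrow>
           l' = l \<and>
           (\<exists>\<pi>. bij_betw \<pi> {..<l} {..<l} \<and>
              (\<forall>k<l. eventually_agree (A k) (A' (\<pi> k)) \<and>
                     iota Mhat (w' (\<pi> k)) = iota Mhat (w k) \<and>
                     (\<forall>N. agree_from N (A k) (A' (\<pi> k)) \<longrightarrow>
                        (\<forall>i\<ge>N. w' (\<pi> k) i = w k i))))))
     \<and>
     (\<forall>M. bratteli M \<and> subdiagram M Mhat \<longrightarrow>
        (\<forall>w\<in>eigseqs M.
           (\<exists>A. maximal_primitive M A \<and> (\<exists>v\<in>eigseqs A. distinguished M A v)) \<and>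
           (\<forall>A. maximal_primitive M A \<longrightarrow>
              (\<forall>v\<in>eigseqs A. distinguished M A v \<longrightarrow>
                 (distinguished Mhat A v \<longleftrightarrow>
                  distinguished (canonical_cover Mhat M) (lower_block A) (lower_vec v))))))"
proof (intro conjI ballI allI impI)
  fix what assume what: "what \<in> Ext Mhat"
  obtain M w where "maximal_primitive Mhat M" "distinguished Mhat M w" "what = iota Mhat w"
    using Ext_maximal_primitive[OF assms what] .
  moreover from this have "w \<in> eigseqs M" by (simp add: distinguished_def)
  ultimately show "\<exists>M. maximal_primitive Mhat M \<and>
      (\<exists>w\<in>eigseqs M. distinguished Mhat M w \<and> what = iota Mhat w)" by blast
next
  fix what M M'
  assume "maximal_primitive Mhat M \<and> (\<exists>w\<in>eigseqs M. distinguished Mhat M w \<and> what = iota Mhat w) \<and>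
    maximal_primitive Mhat M' \<and> (\<exists>w\<in>eigseqs M'. distinguished Mhat M' w \<and> what = iota Mhat w)"
  then show "eventually_agree M M'" using maximal_primitive_unique[OF assms(1)] by metis
next
  fix what assume what: "what \<in> eigseqs Mhat"
  obtain l A where dec: "stream_decomposition Mhat what l A (\<lambda>k. iota (A k) what)"
    and complete: "\<And>M. maximal_primitive Mhat M \<Longrightarrow> iota M what \<in> eigseqs M \<Longrightarrow>
      \<exists>k<l. eventually_agree (A k) M"
    using stream_decomposition_exists[OF assms what] by blast
  show "\<exists>l A w. stream_decomposition Mhat what l A w \<and>
      (\<forall>l' A' w'. stream_decomposition Mhat what l' A' w' \<longrightarrow>
         l' = l \<and>
         (\<exists>\<pi>. bij_betw \<pi> {..<l} {..<l} \<and>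
            (\<forall>k<l. eventually_agree (A k) (A' (\<pi> k)) \<and>
                   iota Mhat (w' (\<pi> k)) = iota Mhat (w k) \<and>
                   (\<forall>N. agree_from N (A k) (A' (\<pi> k)) \<longrightarrow> (\<forall>i\<ge>N. w' (\<pi> k) i = w k i)))))"
    by (rule exI[of _ l], rule exI[of _ A], rule exI[of _ "\<lambda>k. iota (A k) what"],
        intro conjI dec allI impI stream_decomposition_unique[OF assms(1) what dec complete])
next
  fix M w assume M: "bratteli M \<and> subdiagram M Mhat" and w: "w \<in> eigseqs M"
  obtain K where "\<And>i. card (alph Mhat i) \<le> K" using assms(3) unfolding bounded_alphabets_def by blast
  moreover have "card (alph M i) \<le> card (alph Mhat i)" for i
    using M finite_alph[OF assms(1)] by (intro card_mono) (auto simp: subdiagram_def)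
  ultimately have bounded: "bounded_alphabets M" unfolding bounded_alphabets_def by (meson order_trans)
  obtain A where A: "maximal_primitive M A" "iota A w \<in> eigseqs A"
    using maximal_primitive_restriction[OF _ bounded w] M by blast
  have "distinguished M A (iota A w)"
    using maximal_primitiveD[OF A(1)] M eigseqs_eigcone[OF w] A(2) by (intro restriction_distinguished) auto
  then show "\<exists>A. maximal_primitive M A \<and> (\<exists>v\<in>eigseqs A. distinguished M A v)" using A by blast
next
  fix M w A v assume M: "bratteli M \<and> subdiagram M Mhat" and "w \<in> eigseqs M"
    and A: "maximal_primitive M A" and v: "v \<in> eigseqs A" "distinguished M A v"
  show "distinguished Mhat A v \<longleftrightarrow>
      distinguished (canonical_cover Mhat M) (lower_block A) (lower_vec v)"
    using distinguished_cover_iff[OF assms(1) _ _ maximal_primitiveD(2)[OF A] v(2)] M by blast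
qed

end
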